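(* Let $G$ and $G'$ be countable directed graphs. There exists an algebra isomorphism $\tau:\mathfrak{L}_G\to\mathfrak{L}_{G'}$ which is bicontinuous for the weak-$*$ topologies if and only if $G$ and $G'$ are isomorphic as graphs.
   Context: A countable directed graph $G$ has countable vertex set $\mathcal{V}(G)$, edge set $\mathcal{E}(G)$, range and source maps $r,s$; graph isomorphism means bijections of vertices and edges intertwining $r$ and $s$. The free semigroupoid $\mathbb{F}^+(G)$ consists of vertices and finite paths $w=e_k\cdots e_1$ with $s(e_i)=r(e_{i-1})$, $s(w)=s(e_1)$, $r(w)=r(e_k)$. On $\mathcal{H}_G=\ell^2(\mathbb{F}^+(G))$ with orthonormal basis $\{\xi_w\}$, $L_e\xi_w=\xi_{ew}$ if $s(e)=r(w)$ and $0$ otherwise, and $P_v$ is the projection onto $\overline{\operatorname{span}}\{\xi_w:r(w)=v\}$. The tensor algebra $\mathcal{T}_+(G)$ is the norm-closed algebra generated by all $L_e$, $P_v$, and the free semigroupoid algebra $\mathfrak{L}_G$ is its weak operator topology closure in $B(\mathcal{H}_G)$. *)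

theory Defs
  imports "HOL-Analysis.Analysis"
begin

definition countable_graph :: "'v set \<Rightarrow> 'e set \<Rightarrow> ('e \<Rightarrow> 'v) \<Rightarrow> ('e \<Rightarrow> 'v) \<Rightarrow> bool" where
  "countable_graph V E r s \<longleftrightarrow> countable V \<and> countable E \<and> r ` E \<subseteq> V \<and> s ` E \<subseteq> V"

definition graph_iso ::
  "'v set \<Rightarrow> 'e set \<Rightarrow> ('e \<Rightarrow> 'v) \<Rightarrow> ('e \<Rightarrow> 'v) \<Rightarrow>
   'w set \<Rightarrow> 'f set \<Rightarrow> ('f \<Rightarrow> 'w) \<Rightarrow> ('f \<Rightarrow> 'w) \<Rightarrow> bool" where
  "graph_iso V E r s V' E' r' s' \<longleftrightarrow>
     (\<exists>\<phi> \<psi>. bij_betw \<phi> V V' \<and> bij_betw \<psi> E E' \<and>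
        (\<forall>e\<in>E. r' (\<psi> e) = \<phi> (r e) \<and> s' (\<psi> e) = \<phi> (s e)))"

text \<open>An element of the free semigroupoid is encoded as a pair (v, es): es = [] encodes the
  vertex v; a nonempty list es = [e_k, ..., e_1] encodes the path e_k...e_1, and then
  v = r(e_k) is its range.  Thus the first component is always the range r(w).\<close>

definition fsg :: "'v set \<Rightarrow> 'e set \<Rightarrow> ('e \<Rightarrow> 'v) \<Rightarrow> ('e \<Rightarrow> 'v) \<Rightarrow> ('v \<times> 'e list) set" where
  "fsg V E r s = {(v, es). v \<in> V \<and> set es \<subseteq> E \<and> (es \<noteq> [] \<longrightarrow> r (hd es) = v) \<and>
      (\<forall>i. Suc i < length es \<longrightarrow> s (es ! i) = r (es ! Suc i))}"

definition ell2 :: "'p set \<Rightarrow> ('p \<Rightarrow> complex) set" where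
  "ell2 P = {x. (\<forall>p. p \<notin> P \<longrightarrow> x p = 0) \<and> (\<lambda>p. (cmod (x p))\<^sup>2) summable_on UNIV}"

definition hnorm :: "('p \<Rightarrow> complex) \<Rightarrow> real" where
  "hnorm x = sqrt (infsum (\<lambda>p. (cmod (x p))\<^sup>2) UNIV)"

definition iprod :: "('p \<Rightarrow> complex) \<Rightarrow> ('p \<Rightarrow> complex) \<Rightarrow> complex" where
  "iprod x y = infsum (\<lambda>p. x p * cnj (y p)) UNIV"

text \<open>Bounded operators on the Hilbert space H, represented extensionally
  (an operator is a map on functions which vanishes outside H).\<close>

definition bop :: "('p \<Rightarrow> complex) set \<Rightarrow> (('p \<Rightarrow> complex) \<Rightarrow> ('p \<Rightarrow> complex)) set" where
  "bop H = {T. (\<forall>x\<in>H. T x \<in> H) \<and>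
     (\<forall>x\<in>H. \<forall>y\<in>H. \<forall>a b. T (\<lambda>p. a * x p + b * y p) = (\<lambda>p. a * T x p + b * T y p)) \<and>
     (\<exists>C. \<forall>x\<in>H. hnorm (T x) \<le> C * hnorm x) \<and>
     (\<forall>x. x \<notin> H \<longrightarrow> T x = (\<lambda>p. 0))}"

definition opnorm :: "('p \<Rightarrow> complex) set \<Rightarrow> (('p \<Rightarrow> complex) \<Rightarrow> ('p \<Rightarrow> complex)) \<Rightarrow> real" where
  "opnorm H T = Sup ((\<lambda>x. hnorm (T x)) ` {x\<in>H. hnorm x \<le> 1})"

definition op_add where "op_add A B = (\<lambda>x p. A x p + B x p)"
definition op_scale where "op_scale c A = (\<lambda>x p. c * A x p)"

definition norm_top :: "('p \<Rightarrow> complex) set \<Rightarrow> (('p \<Rightarrow> complex) \<Rightarrow> ('p \<Rightarrow> complex)) topology" where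
  "norm_top H = topology_generated_by
     {{S. opnorm H (\<lambda>x p. S x p - T x p) < e} | T e. True}"

definition wot :: "('p \<Rightarrow> complex) set \<Rightarrow> (('p \<Rightarrow> complex) \<Rightarrow> ('p \<Rightarrow> complex)) topology" where
  "wot H = topology_generated_by
     {{S. iprod (S x) y \<in> U} | x y U. x \<in> H \<and> y \<in> H \<and> open U}"

definition sigma_weak_fun ::
  "(nat \<Rightarrow> ('p \<Rightarrow> complex)) \<Rightarrow> (nat \<Rightarrow> ('p \<Rightarrow> complex)) \<Rightarrow>
   (('p \<Rightarrow> complex) \<Rightarrow> ('p \<Rightarrow> complex)) \<Rightarrow> complex" where
  "sigma_weak_fun xs ys S = infsum (\<lambda>n. iprod (S (xs n)) (ys n)) UNIV"

definition weak_star_top :: "('p \<Rightarrow> complex) set \<Rightarrow> (('p \<Rightarrow> complex) \<Rightarrow> ('p \<Rightarrow> complex)) topology" where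
  "weak_star_top H = topology_generated_by
     {{S. sigma_weak_fun xs ys S \<in> U} | xs ys U.
        (\<forall>n. xs n \<in> H \<and> ys n \<in> H) \<and>
        (\<lambda>n. (hnorm (xs n))\<^sup>2) summable_on UNIV \<and>
        (\<lambda>n. (hnorm (ys n))\<^sup>2) summable_on UNIV \<and> open U}"

inductive_set alg_gen :: "(('p \<Rightarrow> complex) \<Rightarrow> ('p \<Rightarrow> complex)) set \<Rightarrow>
    (('p \<Rightarrow> complex) \<Rightarrow> ('p \<Rightarrow> complex)) set" for Gs where
  gen: "A \<in> Gs \<Longrightarrow> A \<in> alg_gen Gs"
| add: "A \<in> alg_gen Gs \<Longrightarrow> B \<in> alg_gen Gs \<Longrightarrow> op_add A B \<in> alg_gen Gs"
| scale: "A \<in> alg_gen Gs \<Longrightarrow> op_scale c A \<in> alg_gen Gs"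
| mult: "A \<in> alg_gen Gs \<Longrightarrow> B \<in> alg_gen Gs \<Longrightarrow> A \<circ> B \<in> alg_gen Gs"

definition HG :: "'v set \<Rightarrow> 'e set \<Rightarrow> ('e \<Rightarrow> 'v) \<Rightarrow> ('e \<Rightarrow> 'v) \<Rightarrow> ('v \<times> 'e list \<Rightarrow> complex) set" where
  "HG V E r s = ell2 (fsg V E r s)"

text \<open>L_e xi_w = xi_{ew} if s(e) = r(w), and 0 otherwise.\<close>
definition Lop :: "'v set \<Rightarrow> 'e set \<Rightarrow> ('e \<Rightarrow> 'v) \<Rightarrow> ('e \<Rightarrow> 'v) \<Rightarrow> 'e \<Rightarrow>
    ('v \<times> 'e list \<Rightarrow> complex) \<Rightarrow> ('v \<times> 'e list \<Rightarrow> complex)" where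
  "Lop V E r s e x = (if x \<in> HG V E r s then
      (\<lambda>(v, es). if es \<noteq> [] \<and> hd es = e \<and> v = r e then x (s e, tl es) else 0)
    else (\<lambda>p. 0))"

definition Pop :: "'v set \<Rightarrow> 'e set \<Rightarrow> ('e \<Rightarrow> 'v) \<Rightarrow> ('e \<Rightarrow> 'v) \<Rightarrow> 'v \<Rightarrow>
    ('v \<times> 'e list \<Rightarrow> complex) \<Rightarrow> ('v \<times> 'e list \<Rightarrow> complex)" where
  "Pop V E r s v x = (if x \<in> HG V E r s then (\<lambda>(u, es). if u = v then x (u, es) else 0)
    else (\<lambda>p. 0))"

definition tensor_alg where
  "tensor_alg V E r s =
     (subtopology (norm_top (HG V E r s)) (bop (HG V E r s))) closure_of
     (alg_gen (Lop V E r s ` E \<union> Pop V E r s ` V))"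

definition fsga where
  "fsga V E r s =
     (subtopology (wot (HG V E r s)) (bop (HG V E r s))) closure_of (tensor_alg V E r s)"

definition alg_iso :: "(('p \<Rightarrow> complex) \<Rightarrow> ('p \<Rightarrow> complex)) set \<Rightarrow>
    (('q \<Rightarrow> complex) \<Rightarrow> ('q \<Rightarrow> complex)) set \<Rightarrow>
    ((('p \<Rightarrow> complex) \<Rightarrow> ('p \<Rightarrow> complex)) \<Rightarrow> (('q \<Rightarrow> complex) \<Rightarrow> ('q \<Rightarrow> complex))) \<Rightarrow> bool" where
  "alg_iso A B \<tau> \<longleftrightarrow> bij_betw \<tau> A B \<and>
     (\<forall>X\<in>A. \<forall>Y\<in>A. \<tau> (op_add X Y) = op_add (\<tau> X) (\<tau> Y) \<and> \<tau> (X \<circ> Y) = \<tau> X \<circ> \<tau> Y) \<and>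
     (\<forall>X\<in>A. \<forall>c. \<tau> (op_scale c X) = op_scale c (\<tau> X))"

end

theory Submission
  imports Defs "HOL-Library.Function_Algebras"
begin

text \<open>
  An operator in the free semigroupoid algebra acts as convolution with its coefficient function
  \<open>w \<mapsto> \<langle>T \<xi>\<^bsub>s(w)\<^esub>, \<xi>\<^sub>w\<rangle>\<close> on paths. Conversely, every bounded convolution operator is the
  weak-* limit of its Fejer means with respect to a weight on edges for which only finitely many
  edge words have bounded weight; so the algebra consists exactly of the bounded
  convolution operators, and a weak-* continuous functional is controlled by its values on path
  operators.

  A weak-* continuous character takes the value 1 at exactly one vertex projection \<open>P\<^sub>v\<close>, and all
  characters at \<open>v\<close> agree on idempotents, because the coefficients of an idempotent on nonempty
  words in the loops at \<open>v\<close> vanish. Transporting the characters \<open>T \<mapsto> \<langle>T \<xi>\<^sub>v, \<xi>\<^sub>v\<rangle>\<close> along the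
  isomorphism therefore gives a bijection of the vertices. The coefficient functionals of the edges
  from \<open>v\<close> to \<open>w\<close> are linearly independent derivations relative to two such characters; modulo inner
  ones, the transported derivations are determined by their values on the edges between the
  corresponding vertices of the other graph, which compares the numbers of edges.

  In the other direction, a graph isomorphism induces a unitary that conjugates one algebra onto
  the other.
\<close>


subsection \<open>Square-summable families\<close>

lemma zero_in_ell2 [simp]: "(\<lambda>p. 0) \<in> ell2 P"
  by (simp add: ell2_def)

lemma ell2_outside: "x \<in> ell2 P \<Longrightarrow> p \<notin> P \<Longrightarrow> x p = 0"
  by (simp add: ell2_def)

lemma ell2_summable: "x \<in> ell2 P \<Longrightarrow> (\<lambda>p. (cmod (x p))\<^sup>2) summable_on UNIV"
  by (simp add: ell2_def)

lemma hnorm_nonneg [simp]: "0 \<le> hnorm x"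
  by (simp add: hnorm_def infsum_nonneg)

lemma hnorm_zero [simp]: "hnorm (\<lambda>p. 0) = 0"
  by (simp add: hnorm_def)

lemma hnorm_power2: "(hnorm x)\<^sup>2 = (\<Sum>\<^sub>\<infinity>p. (cmod (x p))\<^sup>2)"
  by (simp add: hnorm_def infsum_nonneg)

lemma L2_set_le_hnorm:
  assumes "x \<in> ell2 P"
  shows "L2_set (\<lambda>p. cmod (x p)) W \<le> hnorm x"
proof (cases "finite W")
  case True
  then show ?thesis
    unfolding L2_set_def hnorm_def
    by (intro real_sqrt_le_mono finite_sum_le_infsum ell2_summable[OF assms]) auto
qed simp

lemma sum_le_hnorm_power2:
  assumes "x \<in> ell2 P"
  shows "(\<Sum>p\<in>W. (cmod (x p))\<^sup>2) \<le> (hnorm x)\<^sup>2"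
  using power_mono[OF L2_set_le_hnorm[OF assms, of W], of 2] by (simp add: L2_set_def sum_nonneg)

lemma cmod_le_hnorm: "x \<in> ell2 P \<Longrightarrow> cmod (x p) \<le> hnorm x"
  using L2_set_le_hnorm[of x P "{p}"] by simp

lemma
  assumes "\<And>W. finite W \<Longrightarrow> L2_set (\<lambda>p. cmod (x p)) W \<le> B"
  shows summable_if_L2_set_le: "(\<lambda>p. (cmod (x p))\<^sup>2) summable_on UNIV"
    and hnorm_le_if_L2_set_le: "hnorm x \<le> B"
proof -
  have "0 \<le> B"
    using assms[of "{}"] by simp
  have sum_le: "(\<Sum>p\<in>W. (cmod (x p))\<^sup>2) \<le> B\<^sup>2" if "finite W" for W
    using power_mono[OF assms[OF that], of 2] by (simp add: L2_set_def sum_nonneg)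
  show summable: "(\<lambda>p. (cmod (x p))\<^sup>2) summable_on UNIV"
    by (rule nonneg_bdd_above_summable_on) (auto intro!: bdd_aboveI[of _ "B\<^sup>2"] sum_le)
  have "(hnorm x)\<^sup>2 \<le> B\<^sup>2"
    unfolding hnorm_power2 by (rule infsum_le_finite_sums[OF summable]) (auto intro: sum_le)
  then show "hnorm x \<le> B"
    using \<open>0 \<le> B\<close> by (rule power2_le_imp_le)
qed

lemma L2_set_lincomb_le:
  assumes "x \<in> ell2 P" "y \<in> ell2 P"
  shows "L2_set (\<lambda>p. cmod (a * x p + b * y p)) W \<le> cmod a * hnorm x + cmod b * hnorm y"
proof -
  have "L2_set (\<lambda>p. cmod (a * x p + b * y p)) W
      \<le> L2_set (\<lambda>p. cmod a * cmod (x p) + cmod b * cmod (y p)) W"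
    by (intro L2_set_mono) (auto simp flip: norm_mult intro: norm_triangle_ineq)
  also have "\<dots> \<le> cmod a * L2_set (\<lambda>p. cmod (x p)) W + cmod b * L2_set (\<lambda>p. cmod (y p)) W"
    by (simp add: L2_set_right_distrib L2_set_triangle_ineq)
  also have "\<dots> \<le> cmod a * hnorm x + cmod b * hnorm y"
    using assms by (intro add_mono mult_left_mono L2_set_le_hnorm) auto
  finally show ?thesis .
qed

lemma ell2_lincomb:
  assumes "x \<in> ell2 P" "y \<in> ell2 P"
  shows "(\<lambda>p. a * x p + b * y p) \<in> ell2 P"
  using summable_if_L2_set_le[OF L2_set_lincomb_le[OF assms]] ell2_outside[OF assms(1)]
    ell2_outside[OF assms(2)]
  by (simp add: ell2_def)

lemma hnorm_lincomb_le:
  "x \<in> ell2 P \<Longrightarrow> y \<in> ell2 P \<Longrightarrow>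
    hnorm (\<lambda>p. a * x p + b * y p) \<le> cmod a * hnorm x + cmod b * hnorm y"
  by (rule hnorm_le_if_L2_set_le[OF L2_set_lincomb_le])

lemma ell2_scale: "x \<in> ell2 P \<Longrightarrow> (\<lambda>p. c * x p) \<in> ell2 P"
  using ell2_lincomb[of x P x c 0] by simp

lemma ell2_diff: "x \<in> ell2 P \<Longrightarrow> y \<in> ell2 P \<Longrightarrow> (\<lambda>p. x p - y p) \<in> ell2 P"
  using ell2_lincomb[of x P y 1 "-1"] by simp

lemma hnorm_scale: "hnorm (\<lambda>p. c * x p) = cmod c * hnorm x"
  by (simp add: hnorm_def norm_mult power_mult_distrib infsum_cmult_right' real_sqrt_mult)

definition pullback :: "'q set \<Rightarrow> ('q \<Rightarrow> 'p) \<Rightarrow> ('p \<Rightarrow> complex) \<Rightarrow> 'q \<Rightarrow> complex" where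
  "pullback A h x = (\<lambda>q. if q \<in> A then x (h q) else 0)"

abbreviation cutoff :: "'p set \<Rightarrow> ('p \<Rightarrow> complex) \<Rightarrow> 'p \<Rightarrow> complex" where
  "cutoff A \<equiv> pullback A (\<lambda>p. p)"

lemma L2_set_pullback_le:
  assumes "x \<in> ell2 P" "inj_on h A" "finite W"
  shows "L2_set (\<lambda>q. cmod (pullback A h x q)) W \<le> hnorm x"
proof -
  have "L2_set (\<lambda>q. cmod (pullback A h x q)) W = L2_set (\<lambda>p. cmod (x p)) (h ` (W \<inter> A))"
  proof -
    have "(\<Sum>q\<in>W. (cmod (pullback A h x q))\<^sup>2) = (\<Sum>q\<in>W \<inter> A. (cmod (x (h q)))\<^sup>2)"
      using \<open>finite W\<close> by (intro sum.mono_neutral_cong_right) (auto simp: pullback_def)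
    then show ?thesis
      unfolding L2_set_def
      using \<open>inj_on h A\<close> by (subst sum.reindex) (auto intro: inj_on_subset)
  qed
  then show ?thesis
    using L2_set_le_hnorm[OF \<open>x \<in> ell2 P\<close>] by simp
qed

lemma hnorm_pullback_le: "x \<in> ell2 P \<Longrightarrow> inj_on h A \<Longrightarrow> hnorm (pullback A h x) \<le> hnorm x"
  by (rule hnorm_le_if_L2_set_le[OF L2_set_pullback_le])

lemma pullback_in_ell2:
  assumes "x \<in> ell2 P" "inj_on h A" "\<And>q. q \<in> A \<Longrightarrow> h q \<in> P \<Longrightarrow> q \<in> Q"
  shows "pullback A h x \<in> ell2 Q"
  using summable_if_L2_set_le[OF L2_set_pullback_le[OF assms(1,2)]] assms(1,3)
  by (auto simp: ell2_def pullback_def)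

lemma cutoff_in_ell2: "x \<in> ell2 P \<Longrightarrow> cutoff A x \<in> ell2 P"
  by (rule pullback_in_ell2) auto

lemma pullback_lincomb:
  "pullback A h (\<lambda>p. a * x p + b * y p) = (\<lambda>q. a * pullback A h x q + b * pullback A h y q)"
  by (auto simp: pullback_def)

definition xi :: "'p \<Rightarrow> 'p \<Rightarrow> complex" where
  "xi p = (\<lambda>q. of_bool (q = p))"

lemma xi_apply: "xi p q = of_bool (q = p)"
  by (simp add: xi_def)

lemma xi_in_ell2 [simp]: "p \<in> P \<Longrightarrow> xi p \<in> ell2 P"
  by (auto simp: ell2_def xi_def intro: finite_nonzero_values_imp_summable_on)

lemma sum_cmod_mult_le:
  assumes "x \<in> ell2 P" "y \<in> ell2 Q"
  shows "(\<Sum>p\<in>W. cmod (x p * cnj (y p))) \<le> hnorm x * hnorm y"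
proof -
  have "(\<Sum>p\<in>W. cmod (x p * cnj (y p))) \<le> L2_set (\<lambda>p. cmod (x p)) W * L2_set (\<lambda>p. cmod (y p)) W"
    using L2_set_mult_ineq[of "\<lambda>p. cmod (x p)" "\<lambda>p. cmod (y p)"] by (simp add: norm_mult)
  also have "\<dots> \<le> hnorm x * hnorm y"
    using assms by (intro mult_mono L2_set_le_hnorm) auto
  finally show ?thesis .
qed

lemma abs_summable_ell2_mult:
  assumes "x \<in> ell2 P" "y \<in> ell2 Q"
  shows "(\<lambda>p. cmod (x p * cnj (y p))) summable_on UNIV"
  by (rule nonneg_bdd_above_summable_on) (auto intro!: bdd_aboveI sum_cmod_mult_le[OF assms])

lemma summable_ell2_mult:
  "x \<in> ell2 P \<Longrightarrow> y \<in> ell2 Q \<Longrightarrow> (\<lambda>p. x p * cnj (y p)) summable_on UNIV"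
  by (rule abs_summable_summable[OF abs_summable_ell2_mult])

lemma cmod_iprod_le:
  assumes "x \<in> ell2 P" "y \<in> ell2 Q"
  shows "cmod (iprod x y) \<le> hnorm x * hnorm y"
proof -
  note summable = abs_summable_ell2_mult[OF assms]
  have "cmod (iprod x y) \<le> (\<Sum>\<^sub>\<infinity>p. cmod (x p * cnj (y p)))"
    unfolding iprod_def by (rule norm_infsum_bound[OF summable])
  also have "\<dots> \<le> hnorm x * hnorm y"
    by (rule infsum_le_finite_sums[OF summable]) (rule sum_cmod_mult_le[OF assms])
  finally show ?thesis .
qed

lemma iprod_zero_right [simp]: "iprod x (\<lambda>p. 0) = 0"
  by (simp add: iprod_def)

lemma iprod_diff_left:
  assumes "x \<in> ell2 P" "y \<in> ell2 P" "z \<in> ell2 P"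
  shows "iprod (\<lambda>p. x p - y p) z = iprod x z - iprod y z"
  using infsum_add[OF summable_ell2_mult[OF assms(1,3)]
      summable_ell2_mult[OF ell2_scale[OF assms(2), of "-1"] assms(3)]]
  by (simp add: iprod_def left_diff_distrib infsum_uminus)

lemma iprod_cutoff_finite: "finite F \<Longrightarrow> iprod x (cutoff F y) = (\<Sum>p\<in>F. x p * cnj (y p))"
  unfolding iprod_def
  by (intro infsumI has_sum_finite_neutralI[of F UNIV]) (auto simp: pullback_def)

lemma iprod_xi: "iprod x (xi p) = x p"
proof -
  have "xi p = cutoff {p} (\<lambda>_. 1)"
    by (auto simp: xi_def pullback_def)
  then show ?thesis
    using iprod_cutoff_finite[of "{p}" x "\<lambda>_. 1"] by simp
qed

lemma iprod_cutoff_split: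
  assumes "x \<in> ell2 P" "y \<in> ell2 P"
  shows "iprod x y = iprod x (cutoff F y) + iprod x (cutoff (- F) y)"
proof -
  have "iprod x y = (\<Sum>\<^sub>\<infinity>p. x p * cnj (cutoff F y p) + x p * cnj (cutoff (- F) y p))"
    unfolding iprod_def by (rule infsum_cong) (auto simp: pullback_def)
  also have "\<dots> = iprod x (cutoff F y) + iprod x (cutoff (- F) y)"
    unfolding iprod_def
    by (intro infsum_add summable_ell2_mult[OF assms(1) cutoff_in_ell2[OF assms(2)]])
  finally show ?thesis .
qed

lemma ell2_tail_small:
  assumes "y \<in> ell2 P" "0 < e"
  obtains F where "finite F" "hnorm (cutoff (- F) y) \<le> e"
proof -
  have "0 < e\<^sup>2"
    using \<open>0 < e\<close> by simp
  then obtain F where "finite F"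
    and F: "dist (\<Sum>p\<in>F. (cmod (y p))\<^sup>2) (\<Sum>\<^sub>\<infinity>p. (cmod (y p))\<^sup>2) \<le> e\<^sup>2"
    using infsum_finite_approximation[OF ell2_summable[OF \<open>y \<in> ell2 P\<close>]] by blast
  have "hnorm (cutoff (- F) y) \<le> e"
  proof (rule hnorm_le_if_L2_set_le)
    fix W :: "'a set"
    assume "finite W"
    have "(\<Sum>p\<in>W. (cmod (cutoff (- F) y p))\<^sup>2) = (\<Sum>p\<in>W - F. (cmod (y p))\<^sup>2)"
      using \<open>finite W\<close> by (intro sum.mono_neutral_cong_right) (auto simp: pullback_def)
    also have "\<dots> = (\<Sum>p\<in>(W - F) \<union> F. (cmod (y p))\<^sup>2) - (\<Sum>p\<in>F. (cmod (y p))\<^sup>2)"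
      using \<open>finite W\<close> \<open>finite F\<close> by (subst sum.union_disjoint) auto
    also have "\<dots> \<le> (hnorm y)\<^sup>2 - (\<Sum>p\<in>F. (cmod (y p))\<^sup>2)"
      by (intro diff_right_mono sum_le_hnorm_power2[OF assms(1)])
    also have "\<dots> \<le> e\<^sup>2"
      using F by (auto simp: hnorm_power2 dist_real_def)
    finally show "L2_set (\<lambda>p. cmod (cutoff (- F) y p)) W \<le> e"
      unfolding L2_set_def using \<open>0 < e\<close> by (intro real_le_lsqrt) auto
  qed
  then show thesis
    using that \<open>finite F\<close> by blast
qed

lemma iprod_tendsto_zero:
  assumes d: "\<And>n. d n \<in> ell2 P" "\<And>n. hnorm (d n) \<le> B" "\<And>p. (\<lambda>n. d n p) \<longlonglongrightarrow> 0"
    and y: "y \<in> ell2 P"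
  shows "(\<lambda>n. iprod (d n) y) \<longlonglongrightarrow> 0"
proof (rule LIMSEQ_I)
  fix e :: real
  assume "0 < e"
  have "0 \<le> B"
    using d(2)[of 0] hnorm_nonneg[of "d 0"] by linarith
  then obtain F where "finite F" and F: "hnorm (cutoff (- F) y) \<le> e / (2 * (B + 1))"
    using ell2_tail_small[OF y, of "e / (2 * (B + 1))"] \<open>0 < e\<close> by auto
  have tail: "cmod (iprod (d n) (cutoff (- F) y)) \<le> e / 2" for n
  proof -
    have "cmod (iprod (d n) (cutoff (- F) y)) \<le> hnorm (d n) * hnorm (cutoff (- F) y)"
      by (rule cmod_iprod_le[OF d(1) cutoff_in_ell2[OF y]])
    also have "\<dots> \<le> B * (e / (2 * (B + 1)))"
      using d(2) F \<open>0 \<le> B\<close> by (intro mult_mono) auto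
    also have "\<dots> \<le> e / 2"
      using \<open>0 \<le> B\<close> \<open>0 < e\<close> by (simp add: field_simps)
    finally show ?thesis .
  qed
  have "(\<lambda>n. \<Sum>p\<in>F. d n p * cnj (y p)) \<longlonglongrightarrow> (\<Sum>p\<in>F. 0 * cnj (y p))"
    by (intro tendsto_sum tendsto_mult d tendsto_const)
  then have "(\<lambda>n. iprod (d n) (cutoff F y)) \<longlonglongrightarrow> 0"
    by (simp add: iprod_cutoff_finite[OF \<open>finite F\<close>])
  then obtain N where head: "cmod (iprod (d n) (cutoff F y)) < e / 2" if "n \<ge> N" for n
    using LIMSEQ_D[of _ 0 "e / 2"] \<open>0 < e\<close> by auto
  show "\<exists>N. \<forall>n\<ge>N. norm (iprod (d n) y - 0) < e"
  proof (intro exI allI impI)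
    fix n
    assume "N \<le> n"
    then show "norm (iprod (d n) y - 0) < e"
      using head[of n] tail[of n] iprod_cutoff_split[OF d(1) y, of n F]
        norm_triangle_ineq[of "iprod (d n) (cutoff F y)" "iprod (d n) (cutoff (- F) y)"]
      by simp
  qed
qed

lemma iprod_tendsto:
  assumes z: "\<And>n. z n \<in> ell2 P" "\<And>n. hnorm (z n) \<le> B" "\<And>p. (\<lambda>n. z n p) \<longlonglongrightarrow> l p"
    and l: "l \<in> ell2 P" and y: "y \<in> ell2 P"
  shows "(\<lambda>n. iprod (z n) y) \<longlonglongrightarrow> iprod l y"
proof -
  have "hnorm (\<lambda>p. z n p - l p) \<le> B + hnorm l" for n
    using hnorm_lincomb_le[OF z(1)[of n] l, of 1 "-1"] z(2)[of n] by simp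
  then have "(\<lambda>n. iprod (\<lambda>p. z n p - l p) y) \<longlonglongrightarrow> 0"
    by (rule iprod_tendsto_zero[OF ell2_diff[OF z(1) l] _ LIM_zero[OF z(3)] y])
  then show ?thesis
    by (simp add: iprod_diff_left[OF z(1) l y] LIM_zero_iff)
qed

subsection \<open>Averages of compressions to overlapping blocks\<close>

lemma sum_hnorm_cutoff_power2_le:
  assumes "x \<in> ell2 P" "finite J" "\<And>p. card {j\<in>J. p \<in> B j} \<le> n"
  shows "(\<Sum>j\<in>J. (hnorm (cutoff (B j) x))\<^sup>2) \<le> n * (hnorm x)\<^sup>2"
proof -
  let ?f = "\<lambda>p j. (cmod (cutoff (B j) x p))\<^sup>2"
  have summable: "(\<lambda>p. ?f p j) summable_on UNIV" for j
    by (rule ell2_summable[OF cutoff_in_ell2[OF assms(1)]])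
  have "((\<lambda>p. \<Sum>j\<in>J. ?f p j) has_sum (\<Sum>j\<in>J. \<Sum>\<^sub>\<infinity>p. ?f p j)) UNIV"
    using \<open>finite J\<close>
    by (induction J rule: finite_induct) (simp_all add: has_sum_add has_sum_infsum summable)
  moreover have "((\<lambda>p. n * (cmod (x p))\<^sup>2) has_sum (n * (hnorm x)\<^sup>2)) UNIV"
    unfolding hnorm_power2
    by (intro has_sum_cmult_right has_sum_infsum ell2_summable[OF assms(1)])
  moreover have "(\<Sum>j\<in>J. ?f p j) \<le> n * (cmod (x p))\<^sup>2" for p
  proof -
    have "(\<Sum>j\<in>J. ?f p j) = (\<Sum>j\<in>J. of_bool (p \<in> B j) * (cmod (x p))\<^sup>2)"
      by (intro sum.cong) (auto simp: pullback_def)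
    also have "\<dots> = card {j\<in>J. p \<in> B j} * (cmod (x p))\<^sup>2"
      using \<open>finite J\<close> by (simp add: sum_of_bool_eq Int_def flip: sum_distrib_right)
    also have "\<dots> \<le> n * (cmod (x p))\<^sup>2"
      using assms(3) by (intro mult_right_mono) auto
    finally show ?thesis .
  qed
  ultimately show ?thesis
    unfolding hnorm_power2[of "cutoff _ x"] by (rule has_sum_mono)
qed

lemma sum_cmod_sum_cutoff_power2_le:
  assumes "\<And>j. j \<in> J \<Longrightarrow> y j \<in> ell2 P" "finite J" "\<And>p. card {j\<in>J. p \<in> B j} \<le> n"
  shows "(\<Sum>p\<in>W. (cmod (\<Sum>j\<in>J. cutoff (B j) (y j) p))\<^sup>2) \<le> n * (\<Sum>j\<in>J. (hnorm (y j))\<^sup>2)"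
proof -
  let ?z = "\<lambda>p. \<Sum>j\<in>J. cutoff (B j) (y j) p"
  have pointwise: "(cmod (?z p))\<^sup>2 \<le> n * (\<Sum>j\<in>J. (cmod (y j p))\<^sup>2)" for p
  proof -
    have "cmod (?z p) \<le> (\<Sum>j\<in>J. of_bool (p \<in> B j) * cmod (y j p))"
      by (rule sum_norm_le) (simp add: pullback_def)
    then have "(cmod (?z p))\<^sup>2 \<le> (\<Sum>j\<in>J. of_bool (p \<in> B j) * cmod (y j p))\<^sup>2"
      by (intro power_mono) auto
    also have "\<dots> \<le> (\<Sum>j\<in>J. (of_bool (p \<in> B j))\<^sup>2) * (\<Sum>j\<in>J. (cmod (y j p))\<^sup>2)"
      by (rule Cauchy_Schwarz_ineq_sum)
    also have "(\<Sum>j\<in>J. (of_bool (p \<in> B j) :: real)\<^sup>2) = card {j\<in>J. p \<in> B j}"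
      using \<open>finite J\<close> by (simp add: sum_of_bool_eq Int_def power2_eq_square flip: of_bool_conj)
    also have "\<dots> * (\<Sum>j\<in>J. (cmod (y j p))\<^sup>2) \<le> n * (\<Sum>j\<in>J. (cmod (y j p))\<^sup>2)"
      using assms(3) by (intro mult_right_mono sum_nonneg) auto
    finally show ?thesis .
  qed
  have "(\<Sum>p\<in>W. (cmod (?z p))\<^sup>2) \<le> (\<Sum>p\<in>W. n * (\<Sum>j\<in>J. (cmod (y j p))\<^sup>2))"
    by (intro sum_mono pointwise)
  also have "\<dots> = n * (\<Sum>j\<in>J. \<Sum>p\<in>W. (cmod (y j p))\<^sup>2)"
    by (subst sum.swap) (simp add: sum_distrib_left)
  also have "\<dots> \<le> n * (\<Sum>j\<in>J. (hnorm (y j))\<^sup>2)"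
    using assms(1) by (intro mult_left_mono sum_mono sum_le_hnorm_power2) auto
  finally show ?thesis .
qed

lemma L2_set_block_average_le:
  assumes T: "\<And>x. x \<in> ell2 P \<Longrightarrow> T x \<in> ell2 P" "\<And>x. x \<in> ell2 P \<Longrightarrow> hnorm (T x) \<le> C * hnorm x"
    and "0 \<le> C" "x \<in> ell2 P" "finite J" "\<And>p. card {j\<in>J. p \<in> B j} \<le> n"
  shows "L2_set (\<lambda>p. cmod ((\<Sum>j\<in>J. cutoff (B j) (T (cutoff (B j) x)) p) / n)) W \<le> C * hnorm x"
proof (cases "n = 0")
  case True
  then show ?thesis
    using \<open>0 \<le> C\<close> by (simp add: L2_set_def)
next
  case False
  let ?S = "\<lambda>p. \<Sum>j\<in>J. cutoff (B j) (T (cutoff (B j) x)) p"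
  have "(\<Sum>p\<in>W. (cmod (?S p))\<^sup>2) \<le> n * (\<Sum>j\<in>J. (hnorm (T (cutoff (B j) x)))\<^sup>2)"
    by (intro sum_cmod_sum_cutoff_power2_le[OF T(1)[OF cutoff_in_ell2]] assms)
  also have "\<dots> \<le> n * (\<Sum>j\<in>J. (C * hnorm (cutoff (B j) x))\<^sup>2)"
    by (intro mult_left_mono sum_mono power_mono T cutoff_in_ell2 assms) auto
  also have "\<dots> = n * C\<^sup>2 * (\<Sum>j\<in>J. (hnorm (cutoff (B j) x))\<^sup>2)"
    by (simp add: power_mult_distrib sum_distrib_left mult.assoc)
  also have "\<dots> \<le> n * C\<^sup>2 * (n * (hnorm x)\<^sup>2)"
    by (intro mult_left_mono sum_hnorm_cutoff_power2_le[OF assms(4)] assms) auto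
  also have "\<dots> = (n * (C * hnorm x))\<^sup>2"
    by (simp add: power_mult_distrib power2_eq_square mult_ac)
  finally have "L2_set (\<lambda>p. cmod (?S p)) W \<le> n * (C * hnorm x)"
    unfolding L2_set_def using \<open>0 \<le> C\<close> by (intro real_le_lsqrt) auto
  moreover have "L2_set (\<lambda>p. cmod (?S p / n)) W = 1 / n * L2_set (\<lambda>p. cmod (?S p)) W"
    using L2_set_right_distrib[of "1 / n" "\<lambda>p. cmod (?S p)" W] by (simp add: norm_divide)
  ultimately show ?thesis
    using False by (simp add: pos_divide_le_eq mult_ac)
qed

subsection \<open>Bounded operators\<close>

lemma bop_apply_in: "T \<in> bop H \<Longrightarrow> x \<in> H \<Longrightarrow> T x \<in> H"
  by (simp add: bop_def)

lemma bop_lincomb: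
  "T \<in> bop H \<Longrightarrow> x \<in> H \<Longrightarrow> y \<in> H \<Longrightarrow>
    T (\<lambda>p. a * x p + b * y p) = (\<lambda>p. a * T x p + b * T y p)"
  by (simp add: bop_def)

lemma bop_outside: "T \<in> bop H \<Longrightarrow> x \<notin> H \<Longrightarrow> T x = (\<lambda>p. 0)"
  by (simp add: bop_def)

lemma bop_bound:
  assumes "T \<in> bop H"
  obtains C where "0 \<le> C" "\<And>x. x \<in> H \<Longrightarrow> hnorm (T x) \<le> C * hnorm x"
proof -
  obtain C where C: "\<And>x. x \<in> H \<Longrightarrow> hnorm (T x) \<le> C * hnorm x"
    using assms unfolding bop_def by blast
  have "hnorm (T x) \<le> max C 0 * hnorm x" if "x \<in> H" for x
    using C[OF that] mult_right_mono[of C "max C 0" "hnorm x"] by simp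
  then show thesis
    using that[of "max C 0"] by simp
qed

lemma bopI:
  assumes "\<And>x. x \<in> H \<Longrightarrow> T x \<in> H"
    "\<And>x y a b. x \<in> H \<Longrightarrow> y \<in> H \<Longrightarrow> T (\<lambda>p. a * x p + b * y p) = (\<lambda>p. a * T x p + b * T y p)"
    "\<And>x. x \<in> H \<Longrightarrow> hnorm (T x) \<le> C * hnorm x"
    "\<And>x. x \<notin> H \<Longrightarrow> T x = (\<lambda>p. 0)"
  shows "T \<in> bop H"
  using assms unfolding bop_def by blast

lemma bop_scale: "T \<in> bop H \<Longrightarrow> x \<in> H \<Longrightarrow> T (\<lambda>p. c * x p) = (\<lambda>p. c * T x p)"
  using bop_lincomb[of T H x x c 0] by simp

lemma bop_zero: "T \<in> bop (ell2 P) \<Longrightarrow> T (\<lambda>p. 0) = (\<lambda>p. 0)"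
  using bop_scale[of T "ell2 P" "\<lambda>p. 0" 0] by simp

lemma bop_eq_0_outside:
  assumes "T \<in> bop (ell2 P)" "\<not> (x \<in> ell2 P \<and> p \<in> P)"
  shows "T x p = 0"
  using assms ell2_outside[OF bop_apply_in[OF assms(1)]] bop_outside[OF assms(1)]
  by (cases "x \<in> ell2 P") auto

lemma bop_ext:
  assumes "S \<in> bop (ell2 P)" "T \<in> bop (ell2 P)"
    and "\<And>x p. x \<in> ell2 P \<Longrightarrow> p \<in> P \<Longrightarrow> S x p = T x p"
  shows "S = T"
proof (intro ext)
  fix x p
  show "S x p = T x p"
    using assms(3)[of x p] bop_eq_0_outside[OF assms(1)] bop_eq_0_outside[OF assms(2)]
    by (cases "x \<in> ell2 P \<and> p \<in> P") auto
qed

lemma lincomb_in_bop: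
  assumes S: "S \<in> bop (ell2 P)" and T: "T \<in> bop (ell2 P)"
  shows "(\<lambda>x p. a * S x p + b * T x p) \<in> bop (ell2 P)"
proof -
  obtain C where "0 \<le> C" and C: "\<And>x. x \<in> ell2 P \<Longrightarrow> hnorm (S x) \<le> C * hnorm x"
    using bop_bound[OF S] by blast
  obtain D where "0 \<le> D" and D: "\<And>x. x \<in> ell2 P \<Longrightarrow> hnorm (T x) \<le> D * hnorm x"
    using bop_bound[OF T] by blast
  show ?thesis
  proof (rule bopI[where C = "cmod a * C + cmod b * D"])
    fix x
    assume x: "x \<in> ell2 P"
    show "(\<lambda>p. a * S x p + b * T x p) \<in> ell2 P"
      by (intro ell2_lincomb bop_apply_in[OF S] bop_apply_in[OF T] x)
    have "hnorm (\<lambda>p. a * S x p + b * T x p) \<le> cmod a * hnorm (S x) + cmod b * hnorm (T x)"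
      by (rule hnorm_lincomb_le[OF bop_apply_in[OF S x] bop_apply_in[OF T x]])
    also have "\<dots> \<le> cmod a * (C * hnorm x) + cmod b * (D * hnorm x)"
      by (intro add_mono mult_left_mono C D x) auto
    finally show "hnorm (\<lambda>p. a * S x p + b * T x p) \<le> (cmod a * C + cmod b * D) * hnorm x"
      by (simp add: algebra_simps)
  next
    fix x y c d
    assume "x \<in> ell2 P" "y \<in> ell2 P"
    then show "(\<lambda>p. a * S (\<lambda>p. c * x p + d * y p) p + b * T (\<lambda>p. c * x p + d * y p) p) =
       (\<lambda>p. c * (a * S x p + b * T x p) + d * (a * S y p + b * T y p))"
      by (simp add: bop_lincomb[OF S] bop_lincomb[OF T] algebra_simps)
  qed (simp add: bop_outside[OF S] bop_outside[OF T])
qed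

lemma op_add_in_bop: "S \<in> bop (ell2 P) \<Longrightarrow> T \<in> bop (ell2 P) \<Longrightarrow> op_add S T \<in> bop (ell2 P)"
  using lincomb_in_bop[of S P T 1 1] by (simp add: op_add_def)

lemma op_scale_in_bop: "S \<in> bop (ell2 P) \<Longrightarrow> op_scale c S \<in> bop (ell2 P)"
  using lincomb_in_bop[of S P S c 0] by (simp add: op_scale_def)

lemma comp_in_bop:
  assumes S: "S \<in> bop (ell2 P)" and T: "T \<in> bop (ell2 P)"
  shows "S \<circ> T \<in> bop (ell2 P)"
proof -
  obtain C where C: "0 \<le> C" "\<And>x. x \<in> ell2 P \<Longrightarrow> hnorm (S x) \<le> C * hnorm x"
    using bop_bound[OF S] by blast
  obtain D where "0 \<le> D" and D: "\<And>x. x \<in> ell2 P \<Longrightarrow> hnorm (T x) \<le> D * hnorm x"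
    using bop_bound[OF T] by blast
  show ?thesis
  proof (rule bopI[where C = "C * D"])
    fix x
    assume x: "x \<in> ell2 P"
    then show "(S \<circ> T) x \<in> ell2 P"
      by (simp add: bop_apply_in[OF S] bop_apply_in[OF T])
    have "hnorm (S (T x)) \<le> C * (D * hnorm x)"
      using C(2)[OF bop_apply_in[OF T x]] mult_left_mono[OF D[OF x] C(1)] by linarith
    then show "hnorm ((S \<circ> T) x) \<le> C * D * hnorm x"
      by (simp add: mult.assoc)
  next
    fix x y a b
    assume "x \<in> ell2 P" "y \<in> ell2 P"
    then show "(S \<circ> T) (\<lambda>p. a * x p + b * y p) = (\<lambda>p. a * (S \<circ> T) x p + b * (S \<circ> T) y p)"
      by (simp add: bop_lincomb[OF S] bop_lincomb[OF T] bop_apply_in[OF T])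
  qed (simp add: bop_outside[OF T] bop_zero[OF S])
qed

lemma hnorm_le_opnorm:
  assumes T: "T \<in> bop (ell2 P)" and x: "x \<in> ell2 P"
  shows "hnorm (T x) \<le> opnorm (ell2 P) T * hnorm x"
proof -
  obtain C where C: "0 \<le> C" "\<And>x. x \<in> ell2 P \<Longrightarrow> hnorm (T x) \<le> C * hnorm x"
    using bop_bound[OF T] by blast
  show ?thesis
  proof (cases "hnorm x = 0")
    case True
    then show ?thesis
      using C(2)[OF x] by simp
  next
    case False
    then have "0 < hnorm x"
      using hnorm_nonneg[of x] by linarith
    let ?y = "\<lambda>p. complex_of_real (1 / hnorm x) * x p"
    have y: "?y \<in> ell2 P" "hnorm ?y = 1"
      using ell2_scale[OF x] \<open>0 < hnorm x\<close> by (simp_all add: hnorm_scale del: of_real_divide)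
    have "hnorm (T ?y) \<le> opnorm (ell2 P) T"
      unfolding opnorm_def
    proof (rule cSup_upper)
      show "bdd_above ((\<lambda>x. hnorm (T x)) ` {x \<in> ell2 P. hnorm x \<le> 1})"
      proof (rule bdd_aboveI2)
        fix x
        assume "x \<in> {x \<in> ell2 P. hnorm x \<le> 1}"
        then show "hnorm (T x) \<le> C"
          using C(2)[of x] mult_left_mono[of "hnorm x" 1 C] C(1) by simp
      qed
    qed (use y in auto)
    moreover have "hnorm (T ?y) = hnorm (T x) / hnorm x"
      unfolding bop_scale[OF T x] hnorm_scale using \<open>0 < hnorm x\<close> by (simp del: of_real_divide)
    ultimately show ?thesis
      using \<open>0 < hnorm x\<close> by (simp add: pos_divide_le_eq)
  qed
qed

lemma opnorm_zero: "opnorm (ell2 P) (\<lambda>x p. 0) = 0"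
proof -
  have "(\<lambda>x::'a \<Rightarrow> complex. 0::real) ` {x \<in> ell2 P. hnorm x \<le> 1} = {0}"
    by (rule image_constant[of "\<lambda>p. 0"]) simp
  then show ?thesis
    by (simp add: opnorm_def)
qed

subsection \<open>Topologies on operators\<close>

definition initial_topology :: "('a \<Rightarrow> 'b::topological_space) set \<Rightarrow> 'a topology" where
  "initial_topology F = topology_generated_by {f -` U | f U. f \<in> F \<and> open U}"

lemma topspace_initial_topology:
  assumes "F \<noteq> {}"
  shows "topspace (initial_topology F) = UNIV"
proof -
  obtain f where "f \<in> F"
    using assms by blast
  then have "UNIV \<in> {f -` U | f U. f \<in> F \<and> open U}"
    by (intro CollectI exI[of _ f] exI[of _ UNIV]) simp
  then show ?thesis
    unfolding initial_topology_def topology_generated_by_topspace by blast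
qed

lemma continuous_map_from_initial_topology:
  assumes "f \<in> F"
  shows "continuous_map (initial_topology F) euclidean f"
proof -
  have "openin (initial_topology F) (f -` U)" if "open U" for U
    unfolding initial_topology_def
    by (rule topology_generated_by_Basis) (use assms that in blast)
  moreover have "topspace (initial_topology F) = UNIV"
    using assms by (intro topspace_initial_topology) blast
  ultimately show ?thesis
    by (simp add: continuous_map_def vimage_def)
qed

lemma continuous_map_into_initial_topology:
  assumes "F \<noteq> {}" "\<And>f. f \<in> F \<Longrightarrow> continuous_map X euclidean (f \<circ> g)"
  shows "continuous_map X (initial_topology F) g"
  unfolding initial_topology_def
proof (rule continuous_on_generated_topo)
  show "g ` topspace X \<subseteq> \<Union> {f -` U | f U. f \<in> F \<and> open U}"
    using topspace_initial_topology[OF assms(1)] by (simp add: initial_topology_def)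
  fix A
  assume "A \<in> {f -` U | f U. f \<in> F \<and> open U}"
  then obtain f U where "A = f -` U" "f \<in> F" "open U"
    by blast
  then show "openin X (g -` A \<inter> topspace X)"
    using assms(2)[of f]
    by (auto simp: continuous_map_alt vimage_comp Int_commute)
qed

lemma limitin_initial_topologyI:
  assumes "F \<noteq> {}" "\<And>f. f \<in> F \<Longrightarrow> ((\<lambda>n. f (g n)) \<longlongrightarrow> f l) net"
  shows "limitin (initial_topology F) g l net"
  unfolding limitin_def
proof (intro conjI allI impI)
  show "l \<in> topspace (initial_topology F)"
    using assms(1) by (simp add: topspace_initial_topology)
  fix A
  assume "openin (initial_topology F) A \<and> l \<in> A"
  then have "generate_topology_on {f -` U | f U. f \<in> F \<and> open U} A" "l \<in> A"
    by (auto simp: initial_topology_def openin_topology_generated_by_iff)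
  then show "\<forall>\<^sub>F n in net. g n \<in> A"
  proof (induction rule: generate_topology_on.induct)
    case (Int a b)
    then show ?case
      by (auto intro: eventually_conj)
  next
    case (UN K)
    then obtain k where "k \<in> K" "\<forall>\<^sub>F n in net. g n \<in> k"
      by blast
    then show ?case
      by (elim eventually_mono) blast
  next
    case (Basis A)
    then show ?case
      using topological_tendstoD[OF assms(2)] by auto
  qed simp
qed

lemma limitin_subtopology_closure_of:
  assumes "limitin (subtopology X A) f l sequentially" "\<And>n::nat. f n \<in> S"
  shows "l \<in> subtopology X A closure_of S"
  unfolding in_closure_of
proof (intro conjI allI impI)
  show "l \<in> topspace (subtopology X A)"
    by (rule limitin_topspace[OF assms(1)])
  fix U
  assume "l \<in> U \<and> openin (subtopology X A) U"
  then have "\<forall>\<^sub>F n in sequentially. f n \<in> U"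
    using assms(1) by (auto simp: limitin_def)
  then show "\<exists>y. y \<in> S \<and> y \<in> U"
    using assms(2) by (auto simp: eventually_sequentially)
qed

lemma vimages_of_binary_family:
  "{f -` U | f U. (\<exists>x y. f = \<phi> x y \<and> R x y) \<and> open U} =
    {{S. \<phi> x y S \<in> U} | x y U. R x y \<and> open U}"
  unfolding vimage_def by blast

definition wot_functionals ::
  "('p \<Rightarrow> complex) set \<Rightarrow> ((('p \<Rightarrow> complex) \<Rightarrow> 'p \<Rightarrow> complex) \<Rightarrow> complex) set" where
  "wot_functionals H = {\<lambda>S. iprod (S x) y | x y. x \<in> H \<and> y \<in> H}"

lemma wot_eq_initial_topology: "wot H = initial_topology (wot_functionals H)"
  unfolding wot_def wot_functionals_def initial_topology_def mem_Collect_eq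
    vimages_of_binary_family[where \<phi> = "\<lambda>x y S. iprod (S x) y"] conj_assoc ..

definition square_summable_seq :: "('p \<Rightarrow> complex) set \<Rightarrow> (nat \<Rightarrow> 'p \<Rightarrow> complex) \<Rightarrow> bool" where
  "square_summable_seq H xs \<longleftrightarrow>
    (\<forall>n. xs n \<in> H) \<and> (\<lambda>n. (hnorm (xs n))\<^sup>2) summable_on UNIV"

lemma square_summable_seq_if_finite_support:
  assumes "\<And>n. xs n \<in> H" "finite {n. xs n \<noteq> (\<lambda>p. 0)}"
  shows "square_summable_seq H xs"
  unfolding square_summable_seq_def
proof (intro conjI allI finite_nonzero_values_imp_summable_on)
  have "{n. (hnorm (xs n))\<^sup>2 \<noteq> 0} \<subseteq> {n. xs n \<noteq> (\<lambda>p. 0)}"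
    by auto
  then show "finite {n \<in> UNIV. (hnorm (xs n))\<^sup>2 \<noteq> 0}"
    using assms(2) by (auto intro: finite_subset)
qed (rule assms(1))

definition weak_star_functionals ::
  "('p \<Rightarrow> complex) set \<Rightarrow> ((('p \<Rightarrow> complex) \<Rightarrow> 'p \<Rightarrow> complex) \<Rightarrow> complex) set" where
  "weak_star_functionals H =
    {sigma_weak_fun xs ys | xs ys. square_summable_seq H xs \<and> square_summable_seq H ys}"

lemma weak_star_top_eq_initial_topology:
  "weak_star_top H = initial_topology (weak_star_functionals H)"
  unfolding weak_star_top_def weak_star_functionals_def initial_topology_def
    square_summable_seq_def mem_Collect_eq vimages_of_binary_family conj_assoc
  by (rule arg_cong[where f = topology_generated_by]) (simp add: all_conj_distrib conj_ac)

lemma wot_functionals_nonempty: "wot_functionals (ell2 P) \<noteq> {}"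
  unfolding wot_functionals_def using zero_in_ell2[of P] by blast

lemma weak_star_functionals_nonempty: "weak_star_functionals (ell2 P) \<noteq> {}"
proof -
  have "square_summable_seq (ell2 P) (\<lambda>n p. 0)"
    by (rule square_summable_seq_if_finite_support) auto
  then show ?thesis
    unfolding weak_star_functionals_def by blast
qed

lemma topspace_weak_star_top [simp]: "topspace (weak_star_top (ell2 P)) = UNIV"
  unfolding weak_star_top_eq_initial_topology
  by (rule topspace_initial_topology[OF weak_star_functionals_nonempty])

lemma topspace_norm_top [simp]: "topspace (norm_top H) = UNIV"
proof -
  have "S \<in> {S'. opnorm H (\<lambda>x p. S' x p - S x p) < opnorm H (\<lambda>x p. S x p - S x p) + 1}" for S
    by simp
  then show ?thesis
    unfolding norm_top_def topology_generated_by_topspace by blast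
qed

lemma continuous_map_eval_norm_top:
  assumes x: "x \<in> ell2 P"
  shows "continuous_map (subtopology (norm_top (ell2 P)) (bop (ell2 P))) euclidean (\<lambda>S. S x p)"
    (is "continuous_map ?X _ _")
proof -
  have "\<exists>N. openin ?X N \<and> T \<in> N \<and> (\<forall>S\<in>N. S x p \<in> ball (T x p) e)"
    if T: "T \<in> bop (ell2 P)" and "0 < e" for T e
  proof -
    let ?B = "{S. opnorm (ell2 P) (\<lambda>x p. S x p - T x p) < e / (hnorm x + 1)}"
    have pos: "0 < hnorm x + 1"
      using hnorm_nonneg[of x] by linarith
    have "openin (norm_top (ell2 P)) ?B"
      unfolding norm_top_def by (rule topology_generated_by_Basis) blast
    then have "openin ?X (?B \<inter> bop (ell2 P))"
      by (auto simp: openin_subtopology)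
    moreover have "T \<in> ?B"
      using \<open>0 < e\<close> pos by (simp add: opnorm_zero)
    moreover have "S x p \<in> ball (T x p) e" if S: "S \<in> ?B \<inter> bop (ell2 P)" for S
    proof -
      have diff: "(\<lambda>x p. S x p - T x p) \<in> bop (ell2 P)"
        using lincomb_in_bop[of S P T 1 "-1"] S T by simp
      have "cmod (S x p - T x p) \<le> hnorm (\<lambda>p. S x p - T x p)"
        by (rule cmod_le_hnorm[OF bop_apply_in[OF diff x]])
      also have "\<dots> \<le> opnorm (ell2 P) (\<lambda>x p. S x p - T x p) * hnorm x"
        by (rule hnorm_le_opnorm[OF diff x])
      also have "\<dots> \<le> e / (hnorm x + 1) * hnorm x"
        using S by (intro mult_right_mono) auto
      also have "\<dots> < e"
        using \<open>0 < e\<close> pos by (simp add: field_simps)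
      finally show ?thesis
        by (simp add: dist_norm norm_minus_commute)
    qed
    ultimately show ?thesis
      using T by blast
  qed
  then show ?thesis
    using Met_TC.continuous_map_to_metric[of ?X "\<lambda>S. S x p"] by simp
qed

lemma continuous_map_eval_wot:
  assumes "x \<in> ell2 P" "p \<in> P"
  shows "continuous_map (subtopology (wot (ell2 P)) A) euclidean (\<lambda>S. S x p)"
proof -
  have "(\<lambda>S. iprod (S x) (xi p)) \<in> wot_functionals (ell2 P)"
    unfolding wot_functionals_def using assms xi_in_ell2[of p P] by blast
  then show ?thesis
    unfolding wot_eq_initial_topology iprod_xi
    by (intro continuous_map_from_subtopology continuous_map_from_initial_topology)
qed

lemma continuous_map_eval_weak_star:
  assumes "x \<in> ell2 P" "p \<in> P"
  shows "continuous_map (subtopology (weak_star_top (ell2 P)) A) euclidean (\<lambda>S. S x p)"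
proof -
  let ?xs = "\<lambda>n::nat. if n = 0 then x else (\<lambda>p. 0)"
  let ?ys = "\<lambda>n::nat. if n = 0 then xi p else (\<lambda>p. 0)"
  have "sigma_weak_fun ?xs ?ys = (\<lambda>S. S x p)"
  proof
    fix S :: "('a \<Rightarrow> complex) \<Rightarrow> 'a \<Rightarrow> complex"
    have "sigma_weak_fun ?xs ?ys S = (\<Sum>\<^sub>\<infinity>n\<in>{0}. iprod (S (?xs n)) (?ys n))"
      unfolding sigma_weak_fun_def by (rule infsum_cong_neutral) auto
    then show "sigma_weak_fun ?xs ?ys S = S x p"
      by (simp add: iprod_xi)
  qed
  moreover have "square_summable_seq (ell2 P) ?xs" "square_summable_seq (ell2 P) ?ys"
    using assms
    by (auto intro!: square_summable_seq_if_finite_support intro: finite_subset[of _ "{0}"])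
  ultimately have "(\<lambda>S. S x p) \<in> weak_star_functionals (ell2 P)"
    unfolding weak_star_functionals_def by (intro CollectI exI[of _ ?xs] exI[of _ ?ys]) simp
  then show ?thesis
    unfolding weak_star_top_eq_initial_topology
    by (intro continuous_map_from_subtopology continuous_map_from_initial_topology) assumption
qed

lemma infsum_eq_suminf_dominated:
  fixes f :: "nat \<Rightarrow> 'a::banach"
  assumes "\<And>k. norm (f k) \<le> M k" "summable M"
  shows "infsum f UNIV = suminf f"
proof -
  have abs_summable: "summable (\<lambda>k. norm (f k))"
    by (rule summable_comparison_test'[OF assms(2)]) (use assms(1) in auto)
  then have "f sums suminf f"
    by (rule summable_sums[OF summable_norm_cancel])
  with abs_summable show ?thesis
    by (intro infsumI norm_summable_imp_has_sum)
qed

lemma cmod_iprod_bop_le: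
  assumes "S \<in> bop (ell2 P)" "0 \<le> C" "hnorm (S x) \<le> C * hnorm x" "x \<in> ell2 P" "y \<in> ell2 P"
  shows "cmod (iprod (S x) y) \<le> C * ((hnorm x)\<^sup>2 + (hnorm y)\<^sup>2)"
proof -
  have "cmod (iprod (S x) y) \<le> hnorm (S x) * hnorm y"
    by (rule cmod_iprod_le[OF bop_apply_in[OF assms(1,4)] assms(5)])
  also have "\<dots> \<le> C * hnorm x * hnorm y"
    by (intro mult_right_mono assms) auto
  also have "\<dots> \<le> C * ((hnorm x)\<^sup>2 + (hnorm y)\<^sup>2)"
    unfolding mult.assoc
    using sum_squares_bound[of "hnorm x" "hnorm y"]
      mult_nonneg_nonneg[OF hnorm_nonneg[of x] hnorm_nonneg[of y]]
    by (intro mult_left_mono[OF _ assms(2)]) linarith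
  finally show ?thesis .
qed

lemma summable_hnorm_squares:
  "square_summable_seq H xs \<Longrightarrow> square_summable_seq H ys \<Longrightarrow>
    summable (\<lambda>k. C * ((hnorm (xs k))\<^sup>2 + (hnorm (ys k))\<^sup>2))"
  by (intro summable_mult summable_add summable_on_imp_summable)
    (simp_all add: square_summable_seq_def)

lemma sigma_weak_fun_eq_suminf:
  assumes "S \<in> bop (ell2 P)" "square_summable_seq (ell2 P) xs" "square_summable_seq (ell2 P) ys"
  shows "sigma_weak_fun xs ys S = (\<Sum>k. iprod (S (xs k)) (ys k))"
proof -
  obtain C where C: "0 \<le> C" "\<And>x. x \<in> ell2 P \<Longrightarrow> hnorm (S x) \<le> C * hnorm x"
    using bop_bound[OF assms(1)] by blast
  show ?thesis
    unfolding sigma_weak_fun_def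
    using assms(2,3)
    by (intro infsum_eq_suminf_dominated[OF _ summable_hnorm_squares[of "ell2 P" xs ys C]]
        cmod_iprod_bop_le[OF assms(1)] C) (simp_all add: square_summable_seq_def)
qed

context
  fixes T :: "nat \<Rightarrow> ('p \<Rightarrow> complex) \<Rightarrow> 'p \<Rightarrow> complex" and P l C
  assumes T: "\<And>n. T n \<in> bop (ell2 P)" and l: "l \<in> bop (ell2 P)"
    and C: "0 \<le> C" "\<And>n x. x \<in> ell2 P \<Longrightarrow> hnorm (T n x) \<le> C * hnorm x"
    and pointwise: "\<And>x p. x \<in> ell2 P \<Longrightarrow> p \<in> P \<Longrightarrow> (\<lambda>n. T n x p) \<longlonglongrightarrow> l x p"
begin

lemma iprod_tendsto_if_bounded_pointwise:
  assumes "x \<in> ell2 P" "y \<in> ell2 P"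
  shows "(\<lambda>n. iprod (T n x) y) \<longlonglongrightarrow> iprod (l x) y"
proof (rule iprod_tendsto)
  show "(\<lambda>n. T n x p) \<longlonglongrightarrow> l x p" for p
    using pointwise[OF assms(1)] bop_eq_0_outside[OF T] bop_eq_0_outside[OF l]
    by (cases "p \<in> P") auto
qed (use assms T l C(2) in \<open>auto intro: bop_apply_in\<close>)

lemma limitin_wot_if_bounded_pointwise: "limitin (wot (ell2 P)) T l sequentially"
  unfolding wot_eq_initial_topology
  by (intro limitin_initial_topologyI wot_functionals_nonempty)
    (auto simp: wot_functionals_def intro: iprod_tendsto_if_bounded_pointwise)

lemma sigma_weak_fun_tendsto_if_bounded_pointwise:
  assumes "square_summable_seq (ell2 P) xs" "square_summable_seq (ell2 P) ys"
  shows "(\<lambda>n. sigma_weak_fun xs ys (T n)) \<longlonglongrightarrow> sigma_weak_fun xs ys l"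
proof -
  have in_ell2: "xs k \<in> ell2 P" "ys k \<in> ell2 P" for k
    using assms by (auto simp: square_summable_seq_def)
  let ?M = "\<lambda>k. C * ((hnorm (xs k))\<^sup>2 + (hnorm (ys k))\<^sup>2)"
  have "cmod (iprod (T n (xs k)) (ys k)) \<le> ?M k" for n k
    by (intro cmod_iprod_bop_le[of _ P] T C in_ell2)
  then have "\<forall>\<^sub>F (k, n) in at_top \<times>\<^sub>F sequentially. cmod (iprod (T n (xs k)) (ys k)) \<le> ?M k"
    by (intro always_eventually) simp
  then have "(\<lambda>n. \<Sum>k. iprod (T n (xs k)) (ys k)) \<longlonglongrightarrow> (\<Sum>k. iprod (l (xs k)) (ys k))"
    using iprod_tendsto_if_bounded_pointwise[OF in_ell2] summable_hnorm_squares[OF assms]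
    by (intro tannerys_theorem[THEN conjunct2, THEN conjunct2]) auto
  then show ?thesis
    by (simp add: sigma_weak_fun_eq_suminf[OF _ assms] T l)
qed

lemma limitin_weak_star_if_bounded_pointwise:
  "limitin (weak_star_top (ell2 P)) T l sequentially"
  unfolding weak_star_top_eq_initial_topology
  by (intro limitin_initial_topologyI weak_star_functionals_nonempty)
    (auto simp: weak_star_functionals_def intro: sigma_weak_fun_tendsto_if_bounded_pointwise)

end

subsection \<open>Counting edges\<close>

lemma sum_fun_apply: "(\<Sum>i\<in>I. f i) x = (\<Sum>i\<in>I. f i x)"
  by (induction I rule: infinite_finite_induct) auto

lemma vector_space_fun: "vector_space (\<lambda>(c::'k::field) (x::'b \<Rightarrow> 'k) f. c * x f)"
  by (standard; rule ext; simp add: distrib_left distrib_right)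

lemma fun_in_span_units:
  fixes x :: "'b \<Rightarrow> 'k::field"
  assumes "finite N" "\<And>g. g \<notin> N \<Longrightarrow> x g = 0"
  shows "x \<in> module.span (\<lambda>c x f. c * x f) ((\<lambda>f g. of_bool (g = f)) ` N)"
proof -
  interpret fun_space: vector_space "\<lambda>(c::'k) (x::'b \<Rightarrow> 'k) f. c * x f"
    by (rule vector_space_fun)
  have "x = (\<Sum>f\<in>N. (\<lambda>g. x f * of_bool (g = f)))"
    using assms by (auto simp: fun_eq_iff sum_fun_apply of_bool_def if_distrib cong: if_cong)
  also have "\<dots> \<in> fun_space.span ((\<lambda>f g. of_bool (g = f)) ` N)"
    by (intro fun_space.span_sum fun_space.span_scale fun_space.span_base) auto
  finally show ?thesis .
qed

lemma card_unknowns_le_card_equations: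
  fixes M :: "'a \<Rightarrow> 'b \<Rightarrow> 'k::field"
  assumes "finite N" "finite F"
    and trivial: "\<And>b e. (\<And>f. f \<in> N \<Longrightarrow> (\<Sum>e\<in>F. b e * M e f) = 0) \<Longrightarrow> e \<in> F \<Longrightarrow> b e = 0"
  shows "card F \<le> card N"
proof -
  interpret fun_space: vector_space "\<lambda>(c::'k) (x::'b \<Rightarrow> 'k) f. c * x f"
    by (rule vector_space_fun)
  let ?row = "\<lambda>e f. of_bool (f \<in> N) * M e f" and ?unit = "\<lambda>(f::'b) g. of_bool (g = f) :: 'k"
  have inj: "inj_on ?row F"
  proof (rule inj_onI)
    fix d e
    assume "d \<in> F" "e \<in> F" and eq: "?row d = ?row e"
    have "(\<Sum>c\<in>F. (of_bool (c = d) - of_bool (c = e)) * M c f) = M d f - M e f" for f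
      using \<open>finite F\<close> \<open>d \<in> F\<close> \<open>e \<in> F\<close>
      by (simp add: left_diff_distrib sum_subtractf sum_of_bool_mult_eq)
    then have "(\<Sum>c\<in>F. (of_bool (c = d) - of_bool (c = e)) * M c f) = 0" if "f \<in> N" for f
      using that fun_cong[OF eq, of f] by simp
    from trivial[OF this \<open>d \<in> F\<close>] show "d = e"
      by (simp split: if_splits)
  qed
  have independent: "fun_space.independent (?row ` F)"
  proof (rule fun_space.independent_if_scalars_zero)
    fix b x
    assume "(\<Sum>y\<in>?row ` F. (\<lambda>f. b y * y f)) = 0" "x \<in> ?row ` F"
    then have rows: "(\<Sum>e\<in>F. b (?row e) * ?row e f) = 0" for f
      by (subst (asm) sum.reindex[OF inj]) (simp add: fun_eq_iff sum_fun_apply)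
    have "(\<Sum>e\<in>F. b (?row e) * M e f) = 0" if "f \<in> N" for f
      using rows[of f] that by simp
    then show "b x = 0"
      using trivial[of "\<lambda>e. b (?row e)"] \<open>x \<in> ?row ` F\<close> by blast
  qed (use \<open>finite F\<close> in simp)
  have spanned: "?row ` F \<subseteq> fun_space.span (?unit ` N)"
    using \<open>finite N\<close> by (auto intro!: fun_in_span_units)
  have "card (?row ` F) \<le> card (?unit ` N)"
    using fun_space.independent_span_bound[OF _ independent spanned] \<open>finite N\<close> by simp
  then show ?thesis
    using card_image[OF inj] card_image_le[OF \<open>finite N\<close>, of ?unit] by simp
qed

lemma lepoll_if_finite_subset_card_le:
  assumes "countable A" "\<And>F. finite B \<Longrightarrow> F \<subseteq> A \<Longrightarrow> finite F \<Longrightarrow> card F \<le> card B"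
  shows "A \<lesssim> B"
proof (cases "finite B")
  case True
  then have "finite A \<and> card A \<le> card B"
    by (intro finite_if_finite_subsets_card_bdd assms(2))
  with True show ?thesis
    by (simp add: lepoll_iff_card_le)
next
  case False
  have "A \<lesssim> (UNIV :: nat set)"
    using assms(1) by (auto simp: countable_def lepoll_def)
  also have "(UNIV :: nat set) \<lesssim> B"
    using False by (simp add: infinite_le_lepoll)
  finally show ?thesis .
qed

definition edges_between :: "'e set \<Rightarrow> ('e \<Rightarrow> 'v) \<Rightarrow> ('e \<Rightarrow> 'v) \<Rightarrow> 'v \<Rightarrow> 'v \<Rightarrow> 'e set" where
  "edges_between E r s v w = {e \<in> E. s e = v \<and> r e = w}"

lemma edges_eq_UN_edges_between:
  "countable_graph V E r s \<Longrightarrow> E = (\<Union>(v, w)\<in>V \<times> V. edges_between E r s v w)"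
  by (auto simp: countable_graph_def edges_between_def image_subset_iff)

lemma graph_iso_if_edges_between_eqpoll:
  assumes G: "countable_graph V E r s" and G': "countable_graph V' E' r' s'"
    and \<phi>: "bij_betw \<phi> V V'"
    and "\<And>v w. v \<in> V \<Longrightarrow> w \<in> V \<Longrightarrow> edges_between E r s v w \<approx> edges_between E' r' s' (\<phi> v) (\<phi> w)"
  shows "graph_iso V E r s V' E' r' s'"
proof -
  have "\<forall>v\<in>V. \<forall>w\<in>V. \<exists>h. bij_betw h (edges_between E r s v w) (edges_between E' r' s' (\<phi> v) (\<phi> w))"
    using assms(4) by (auto simp: eqpoll_def)
  then obtain h where
    h: "bij_betw (h v w) (edges_between E r s v w) (edges_between E' r' s' (\<phi> v) (\<phi> w))"
    if "v \<in> V" "w \<in> V" for v w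
    by metis
  define \<psi> where "\<psi> = (\<lambda>e. h (s e) (r e) e)"
  have \<psi>: "bij_betw \<psi> (edges_between E r s v w) (edges_between E' r' s' (\<phi> v) (\<phi> w))"
    if "v \<in> V" "w \<in> V" for v w
    using h[OF that]
    by (rule bij_betw_cong[THEN iffD1, rotated]) (auto simp: \<psi>_def edges_between_def)
  have "bij_betw \<psi> (\<Union>(v, w)\<in>V \<times> V. edges_between E r s v w)
      (\<Union>(v, w)\<in>V \<times> V. edges_between E' r' s' (\<phi> v) (\<phi> w))"
    using \<psi> bij_betw_imp_inj_on[OF \<phi>]
    by (intro bij_betw_UNION_disjoint)
      (auto simp: disjoint_family_on_def edges_between_def dest: inj_onD)
  moreover have "(\<Union>(v, w)\<in>V \<times> V. edges_between E' r' s' (\<phi> v) (\<phi> w)) =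
      (\<Union>(v', w')\<in>V' \<times> V'. edges_between E' r' s' v' w')"
    using bij_betw_imp_surj_on[OF \<phi>] by force
  ultimately have "bij_betw \<psi> E E'"
    using edges_eq_UN_edges_between[OF G] edges_eq_UN_edges_between[OF G'] by simp
  moreover have "r' (\<psi> e) = \<phi> (r e) \<and> s' (\<psi> e) = \<phi> (s e)" if "e \<in> E" for e
  proof -
    have "e \<in> edges_between E r s (s e) (r e)" "s e \<in> V" "r e \<in> V"
      using G that by (auto simp: countable_graph_def edges_between_def image_subset_iff)
    then have "\<psi> e \<in> edges_between E' r' s' (\<phi> (s e)) (\<phi> (r e))"
      using bij_betw_apply[OF \<psi>] by blast
    then show ?thesis
      by (simp add: edges_between_def)
  qed
  ultimately show ?thesis
    unfolding graph_iso_def using \<phi> by blast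
qed

subsection \<open>Paths and convolution operators\<close>

primrec path_source :: "('e \<Rightarrow> 'v) \<Rightarrow> 'v \<Rightarrow> 'e list \<Rightarrow> 'v" where
  "path_source s v [] = v"
| "path_source s v (e # es) = path_source s (s e) es"

lemma path_source_append [simp]:
  "path_source s v (es @ fs) = path_source s (path_source s v es) fs"
  by (induction es arbitrary: v) auto

lemma path_source_take_drop:
  "path_source s (path_source s v (take k es)) (drop k es) = path_source s v es"
  by (metis append_take_drop_id path_source_append)

lemma path_source_loops: "(\<forall>e\<in>set es. s e = v) \<Longrightarrow> path_source s v es = v"
  by (induction es) auto

type_synonym ('v, 'e) path_operator =
  "('v \<times> 'e list \<Rightarrow> complex) \<Rightarrow> 'v \<times> 'e list \<Rightarrow> complex"

definition path_conv :: "('e \<Rightarrow> 'v) \<Rightarrow> ('v \<times> 'e list \<Rightarrow> 'a) \<Rightarrow> ('v \<times> 'e list \<Rightarrow> 'a) \<Rightarrow>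
    'v \<times> 'e list \<Rightarrow> 'a::semiring_0" where
  "path_conv s a b = (\<lambda>(v, es). \<Sum>k\<le>length es.
    a (v, take k es) * b (path_source s v (take k es), drop k es))"

definition path_coef :: "('e \<Rightarrow> 'v) \<Rightarrow> ('v, 'e) path_operator \<Rightarrow>
    'v \<times> 'e list \<Rightarrow> complex" where
  "path_coef s S = (\<lambda>(v, es). S (xi (path_source s v es, [])) (v, es))"

lemma sum_triangle_swap:
  fixes g :: "nat \<Rightarrow> nat \<Rightarrow> 'a::comm_monoid_add"
  shows "(\<Sum>k\<le>N. \<Sum>j\<le>N - k. g k j) = (\<Sum>m\<le>N. \<Sum>k\<le>m. g k (m - k))"
proof -
  have "(\<Sum>k\<le>N. \<Sum>j\<le>N - k. g k j) = (\<Sum>(k, j)\<in>Sigma {..N} (\<lambda>k. {..N - k}). g k j)"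
    by (rule sum.Sigma) auto
  also have "Sigma {..N} (\<lambda>k. {..N - k}) = {(k, j). k + j \<le> N}"
    by auto
  finally show ?thesis
    by (simp only: sum.triangle_reindex_eq)
qed

lemma path_conv_assoc:
  "path_conv s (path_conv s a b) c = path_conv s a (path_conv s b c)"
proof
  fix p :: "'a \<times> 'b list"
  obtain v es where p: "p = (v, es)"
    by fastforce
  let ?v = "\<lambda>k. path_source s v (take k es)"
  let ?g = "\<lambda>k j.
    a (v, take k es) * (b (?v k, take j (drop k es)) * c (?v (k + j), drop (k + j) es))"
  have source: "path_source s (?v k) (take j (drop k es)) = ?v (k + j)" for k j
    by (simp add: take_add)
  have "path_conv s a (path_conv s b c) p = (\<Sum>k\<le>length es. \<Sum>j\<le>length es - k. ?g k j)"
    by (simp add: p path_conv_def sum_distrib_left source add.commute)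
  also have "\<dots> = (\<Sum>m\<le>length es. \<Sum>k\<le>m. ?g k (m - k))"
    by (rule sum_triangle_swap)
  also have "\<dots> = path_conv s (path_conv s a b) c p"
    by (auto simp: p path_conv_def sum_distrib_right mult.assoc min_def
        take_drop intro!: sum.cong split: if_splits)
  finally show "path_conv s (path_conv s a b) c p = path_conv s a (path_conv s b c) p" ..
qed

lemma path_conv_xi_left:
  "path_conv s (xi (u, fs)) b (v, es) =
    (if v = u \<and> take (length fs) es = fs
     then b (path_source s u fs, drop (length fs) es) else 0)"
proof -
  let ?f = "\<lambda>k. xi (u, fs) (v, take k es) * b (path_source s v (take k es), drop k es)"
  have index: "k = length fs" if "k \<le> length es" "take k es = fs" for k
    using that by auto
  have "path_conv s (xi (u, fs)) b (v, es) = (\<Sum>k\<le>length es. ?f k)"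
    by (simp add: path_conv_def)
  also have "\<dots> = (\<Sum>k\<in>{length fs} \<inter> {..length es}. ?f k)"
    using index by (intro sum.mono_neutral_right) (auto simp: xi_apply)
  also have "\<dots> = (if v = u \<and> take (length fs) es = fs
     then b (path_source s u fs, drop (length fs) es) else 0)"
    by (cases "length fs \<le> length es") (auto simp: xi_apply)
  finally show ?thesis .
qed

lemma path_coef_op_add: "path_coef s (op_add S T) p = path_coef s S p + path_coef s T p"
  by (simp add: path_coef_def op_add_def case_prod_unfold)

lemma path_coef_op_scale: "path_coef s (op_scale c S) p = c * path_coef s S p"
  by (simp add: path_coef_def op_scale_def case_prod_unfold)

locale graph =
  fixes V :: "'v set" and E :: "'e set" and r s :: "'e \<Rightarrow> 'v"
  assumes graph: "countable_graph V E r s"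
begin

abbreviation "paths \<equiv> fsg V E r s"
abbreviation "H \<equiv> ell2 (fsg V E r s)"
abbreviation "L \<equiv> Lop V E r s"
abbreviation "P \<equiv> Pop V E r s"
abbreviation "generators \<equiv> L ` E \<union> P ` V"
abbreviation "src \<equiv> path_source s"
abbreviation "conv \<equiv> path_conv s"
abbreviation "coef \<equiv> path_coef s"

lemma source_in_V [simp]: "e \<in> E \<Longrightarrow> s e \<in> V" and range_in_V [simp]: "e \<in> E \<Longrightarrow> r e \<in> V"
  using graph by (auto simp: countable_graph_def)

lemma path_Nil [simp]: "(v, []) \<in> paths \<longleftrightarrow> v \<in> V"
  by (auto simp: fsg_def)

lemma path_Cons [simp]: "(v, e # es) \<in> paths \<longleftrightarrow> e \<in> E \<and> r e = v \<and> (s e, es) \<in> paths"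
proof (cases es)
  case (Cons f fs)
  then show ?thesis
    by (auto simp: fsg_def All_less_Suc2)
qed (auto simp: fsg_def)

lemma path_start: "(v, es) \<in> paths \<Longrightarrow> v \<in> V"
  by (auto simp: fsg_def)

lemma path_append: "(v, es @ fs) \<in> paths \<longleftrightarrow> (v, es) \<in> paths \<and> (src v es, fs) \<in> paths"
  by (induction es arbitrary: v) (auto dest: path_start)

lemma path_take: "(v, es) \<in> paths \<Longrightarrow> (v, take k es) \<in> paths"
  and path_drop: "(v, es) \<in> paths \<Longrightarrow> (src v (take k es), drop k es) \<in> paths"
  by (metis append_take_drop_id path_append)+

lemma path_source_in_V: "(v, es) \<in> paths \<Longrightarrow> src v es \<in> V"
  using path_append[of v es "[]"] by simp

lemma conv_cong:
  assumes "p \<in> paths" "\<And>q. q \<in> paths \<Longrightarrow> a q = a' q" "\<And>q. q \<in> paths \<Longrightarrow> b q = b' q"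
  shows "conv a b p = conv a' b' p"
proof -
  obtain v es where p: "p = (v, es)"
    by fastforce
  show ?thesis
    using assms by (simp add: p path_conv_def path_take path_drop)
qed

definition conv_ops :: "('v, 'e) path_operator set" where
  "conv_ops = {S \<in> bop H. \<forall>x\<in>H. \<forall>p\<in>paths. S x p = conv (coef S) x p}"

lemma conv_opsI:
  "S \<in> bop H \<Longrightarrow> (\<And>x p. x \<in> H \<Longrightarrow> p \<in> paths \<Longrightarrow> S x p = conv (coef S) x p) \<Longrightarrow> S \<in> conv_ops"
  by (simp add: conv_ops_def)

lemma conv_ops_in_bop: "S \<in> conv_ops \<Longrightarrow> S \<in> bop H"
  by (simp add: conv_ops_def)

lemma conv_ops_apply: "S \<in> conv_ops \<Longrightarrow> x \<in> H \<Longrightarrow> p \<in> paths \<Longrightarrow> S x p = conv (coef S) x p"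
  by (simp add: conv_ops_def)

lemma conv_ops_add:
  assumes "S \<in> conv_ops" "T \<in> conv_ops"
  shows "op_add S T \<in> conv_ops"
proof (rule conv_opsI)
  show "op_add S T \<in> bop H"
    using assms by (intro op_add_in_bop conv_ops_in_bop)
  fix x p
  assume "x \<in> H" "p \<in> paths"
  then have "op_add S T x p = conv (coef S) x p + conv (coef T) x p"
    by (simp add: op_add_def conv_ops_apply assms)
  then show "op_add S T x p = conv (coef (op_add S T)) x p"
    by (simp add: path_conv_def path_coef_op_add distrib_right sum.distrib case_prod_unfold)
qed

lemma conv_ops_scale:
  assumes "S \<in> conv_ops"
  shows "op_scale c S \<in> conv_ops"
proof (rule conv_opsI)
  show "op_scale c S \<in> bop H"
    using assms by (intro op_scale_in_bop conv_ops_in_bop)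
  fix x p
  assume "x \<in> H" "p \<in> paths"
  then have "op_scale c S x p = c * conv (coef S) x p"
    by (simp add: op_scale_def conv_ops_apply assms)
  then show "op_scale c S x p = conv (coef (op_scale c S)) x p"
    by (simp add: path_conv_def path_coef_op_scale sum_distrib_left mult.assoc case_prod_unfold)
qed

lemma coef_comp:
  assumes S: "S \<in> conv_ops" and T: "T \<in> conv_ops" and p: "p \<in> paths"
  shows "coef (S \<circ> T) p = conv (coef S) (coef T) p"
proof -
  obtain v es where p_eq: "p = (v, es)"
    by fastforce
  then have "T (xi (src v es, [])) \<in> H"
    using p
    by (intro bop_apply_in[OF conv_ops_in_bop[OF T]] xi_in_ell2) (simp add: path_source_in_V)
  then have "coef (S \<circ> T) p = conv (coef S) (T (xi (src v es, []))) p"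
    using conv_ops_apply[OF S _ p] by (simp add: path_coef_def p_eq)
  then show ?thesis
    by (simp add: path_conv_def path_coef_def[of s T] p_eq path_source_take_drop)
qed

lemma conv_ops_comp:
  assumes S: "S \<in> conv_ops" and T: "T \<in> conv_ops"
  shows "S \<circ> T \<in> conv_ops"
proof (rule conv_opsI)
  show "S \<circ> T \<in> bop H"
    by (intro comp_in_bop conv_ops_in_bop S T)
  fix x p
  assume x: "x \<in> H" and p: "p \<in> paths"
  have "(S \<circ> T) x p = conv (coef S) (T x) p"
    by (simp add: conv_ops_apply[OF S _ p] bop_apply_in[OF conv_ops_in_bop[OF T] x])
  also have "\<dots> = conv (coef S) (conv (coef T) x) p"
    by (intro conv_cong p refl conv_ops_apply[OF T x])
  also have "\<dots> = conv (conv (coef S) (coef T)) x p"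
    by (simp add: path_conv_assoc)
  also have "\<dots> = conv (coef (S \<circ> T)) x p"
    by (intro conv_cong p refl coef_comp[OF S T, symmetric])
  finally show "(S \<circ> T) x p = conv (coef (S \<circ> T)) x p" .
qed

lemma Pop_apply: "x \<in> H \<Longrightarrow> P u x (v, es) = (if v = u then x (v, es) else 0)"
  by (simp add: Pop_def HG_def)

lemma Lop_apply:
  "x \<in> H \<Longrightarrow> L e x (v, es) = (if es \<noteq> [] \<and> hd es = e \<and> v = r e then x (s e, tl es) else 0)"
  by (simp add: Lop_def HG_def)

lemma Pop_in_bop: "P u \<in> bop H"
proof -
  have eq: "P u x = cutoff {p. fst p = u} x" if "x \<in> H" for x
    using that by (auto simp: Pop_def HG_def pullback_def)
  show ?thesis
  proof (rule bopI[where C = 1])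
    show "P u x \<in> H" if "x \<in> H" for x
      using that by (simp add: eq cutoff_in_ell2)
    show "hnorm (P u x) \<le> 1 * hnorm x" if "x \<in> H" for x
      using that hnorm_pullback_le[OF that inj_on_id2] by (simp add: eq)
    show "P u x = (\<lambda>p. 0)" if "x \<notin> H" for x
      using that by (simp add: Pop_def HG_def)
  qed (simp add: eq ell2_lincomb pullback_lincomb)
qed

lemma Lop_in_bop:
  assumes "e \<in> E"
  shows "L e \<in> bop H"
proof -
  let ?A = "{(v, es). es \<noteq> [] \<and> hd es = e \<and> v = r e}" and ?h = "\<lambda>(v, es). (s e, tl es)"
  have inj: "inj_on ?h ?A"
    by (auto simp: inj_on_def intro: list.expand)
  have eq: "L e x = pullback ?A ?h x" if "x \<in> H" for x
    using that by (auto simp: Lop_def HG_def pullback_def)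
  have "q \<in> paths" if "q \<in> ?A" "?h q \<in> paths" for q
    using assms that by (cases q; cases "snd q") auto
  note in_H = pullback_in_ell2[OF _ inj this]
  show ?thesis
  proof (rule bopI[where C = 1])
    show "L e x \<in> H" if "x \<in> H" for x
      unfolding eq[OF that] by (rule in_H[OF that])
    show "hnorm (L e x) \<le> 1 * hnorm x" if "x \<in> H" for x
      unfolding eq[OF that] using hnorm_pullback_le[OF that inj] by simp
    show "L e x = (\<lambda>p. 0)" if "x \<notin> H" for x
      using that by (simp add: Lop_def HG_def)
  qed (simp add: eq ell2_lincomb pullback_lincomb)
qed

lemma coef_Pop: "p \<in> paths \<Longrightarrow> coef (P u) p = xi (u, []) p"
  by (cases p) (auto simp: path_coef_def Pop_apply xi_apply path_source_in_V)

lemma coef_Lop: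
  assumes "p \<in> paths"
  shows "coef (L e) p = xi (r e, [e]) p"
proof -
  obtain v es where p: "p = (v, es)"
    by fastforce
  then have "xi (src v es, []) \<in> H"
    using assms by (simp add: path_source_in_V)
  then show ?thesis
    by (cases es; cases "tl es") (auto simp: p path_coef_def Lop_apply xi_apply)
qed

lemma Pop_in_conv_ops: "P u \<in> conv_ops"
proof (rule conv_opsI[OF Pop_in_bop])
  fix x p
  assume "x \<in> H" "p \<in> paths"
  then have "conv (coef (P u)) x p = conv (xi (u, [])) x p"
    by (intro conv_cong coef_Pop) auto
  then show "P u x p = conv (coef (P u)) x p"
    using \<open>x \<in> H\<close> by (cases p) (simp add: path_conv_xi_left Pop_apply)
qed

lemma Lop_in_conv_ops:
  assumes "e \<in> E"
  shows "L e \<in> conv_ops"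
proof (rule conv_opsI[OF Lop_in_bop[OF assms]])
  fix x p
  assume "x \<in> H" "p \<in> paths"
  then have "conv (coef (L e)) x p = conv (xi (r e, [e])) x p"
    by (intro conv_cong coef_Lop) auto
  moreover obtain v es where "p = (v, es)"
    by fastforce
  ultimately show "L e x p = conv (coef (L e)) x p"
    using \<open>x \<in> H\<close> by (cases es) (auto simp: path_conv_xi_left Lop_apply)
qed

lemma alg_gen_in_conv_ops: "A \<in> alg_gen generators \<Longrightarrow> A \<in> conv_ops"
proof (induction rule: alg_gen.induct)
  case (mult A B)
  show ?case
    by (rule conv_ops_comp) fact+
qed (auto intro: Lop_in_conv_ops Pop_in_conv_ops conv_ops_add conv_ops_scale)

fun path_op :: "'v \<times> 'e list \<Rightarrow> ('v \<times> 'e list \<Rightarrow> complex) \<Rightarrow> 'v \<times> 'e list \<Rightarrow> complex" where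
  "path_op (v, []) = P v"
| "path_op (v, e # es) = L e \<circ> path_op (s e, es)"

lemma path_op_in_alg_gen: "p \<in> paths \<Longrightarrow> path_op p \<in> alg_gen generators"
  by (induction p rule: path_op.induct) (auto intro: alg_gen.intros)

lemma path_op_in_conv_ops: "p \<in> paths \<Longrightarrow> path_op p \<in> conv_ops"
  by (intro alg_gen_in_conv_ops path_op_in_alg_gen)

lemma coef_path_op: "p \<in> paths \<Longrightarrow> q \<in> paths \<Longrightarrow> coef (path_op p) q = xi p q"
proof (induction p arbitrary: q rule: path_op.induct)
  case (2 v e es)
  then have "coef (path_op (v, e # es)) q = conv (coef (L e)) (coef (path_op (s e, es))) q"
    by (simp add: coef_comp Lop_in_conv_ops path_op_in_conv_ops)
  also have "\<dots> = conv (xi (r e, [e])) (xi (s e, es)) q"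
    using 2 by (intro conv_cong coef_Lop) auto
  also have "\<dots> = xi (v, e # es) q"
    using 2 by (cases q; cases "snd q") (auto simp: path_conv_xi_left xi_apply)
  finally show ?case .
qed (simp add: coef_Pop)

lemma closure_of_conv_ops_subset:
  assumes eval: "\<And>x p. x \<in> H \<Longrightarrow> p \<in> paths \<Longrightarrow>
      continuous_map (subtopology X (bop H)) euclidean (\<lambda>S. S x p)"
    and "A \<subseteq> conv_ops"
  shows "subtopology X (bop H) closure_of A \<subseteq> conv_ops"
proof
  let ?X = "subtopology X (bop H)"
  fix T
  assume T: "T \<in> ?X closure_of A"
  have "T \<in> bop H"
    using T closure_of_subset_topspace[of ?X A] by auto
  then show "T \<in> conv_ops"
  proof (rule conv_opsI)
    fix x p
    assume x: "x \<in> H" and p: "p \<in> paths"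
    obtain v es where p_eq: "p = (v, es)"
      by fastforce
    have coef: "continuous_map ?X euclidean (\<lambda>S. coef S q)" if "q \<in> paths" for q
      using eval[OF xi_in_ell2 that] that
      by (cases q) (simp add: path_coef_def path_source_in_V)
    have "continuous_map ?X euclidean (\<lambda>S. conv (coef S) x p)"
      using coef[OF path_take] p
      unfolding continuous_map_atin limitin_canonical_iff path_conv_def p_eq
      by (auto intro!: tendsto_intros)
    then show "T x p = conv (coef T) x p"
      using assms(2) conv_ops_apply[OF _ x p]
      by (intro forall_in_closure_of_eq[OF T _ eval[OF x p]]) auto
  qed
qed

lemma alg_gen_subset_tensor_alg: "alg_gen generators \<subseteq> tensor_alg V E r s"
  unfolding tensor_alg_def HG_def
  by (rule closure_of_subset) (auto dest: alg_gen_in_conv_ops intro: conv_ops_in_bop)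

lemma fsga_subset_conv_ops: "fsga V E r s \<subseteq> conv_ops"
proof -
  have "tensor_alg V E r s \<subseteq> conv_ops"
    unfolding tensor_alg_def HG_def
    by (rule closure_of_conv_ops_subset)
      (auto intro: continuous_map_eval_norm_top alg_gen_in_conv_ops)
  then show ?thesis
    unfolding fsga_def HG_def
    by (intro closure_of_conv_ops_subset) (auto intro: continuous_map_eval_wot)
qed

end

subsection \<open>Fejer means\<close>

lemma finite_to_nat_on_less: "countable A \<Longrightarrow> finite {a \<in> A. to_nat_on A a < n}"
  by (rule inj_on_finite[of "to_nat_on A" _ "{..<n}"])
    (auto intro: inj_on_subset[OF inj_on_to_nat_on])

lemma sum_in_alg_gen:
  assumes "finite I" "A0 \<in> alg_gen Gs" "\<And>i. i \<in> I \<Longrightarrow> A i \<in> alg_gen Gs"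
  shows "(\<lambda>x p. \<Sum>i\<in>I. c i * A i x p) \<in> alg_gen Gs"
  using assms(1,3)
proof (induction I rule: finite_induct)
  case empty
  have "op_scale 0 A0 \<in> alg_gen Gs"
    by (rule alg_gen.scale[OF assms(2)])
  then show ?case
    by (simp add: op_scale_def)
next
  case (insert i I)
  have "op_add (op_scale (c i) (A i)) (\<lambda>x p. \<Sum>i\<in>I. c i * A i x p) \<in> alg_gen Gs"
    by (intro alg_gen.add alg_gen.scale insert) auto
  then show ?case
    using insert by (simp add: op_add_def op_scale_def)
qed

lemma alg_gen_empty: "alg_gen {} = {}"
proof -
  have "A \<notin> alg_gen {}" for A :: "('p \<Rightarrow> complex) \<Rightarrow> 'p \<Rightarrow> complex"
  proof
    assume "A \<in> alg_gen {}"
    then show False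
      by induction auto
  qed
  then show ?thesis
    by blast
qed

context graph
begin

definition weight :: "'e list \<Rightarrow> nat" where
  "weight es = (\<Sum>e\<leftarrow>es. Suc (to_nat_on E e))"

lemma weight_append: "weight (es @ fs) = weight es + weight fs"
  by (simp add: weight_def)

lemma weight_take_drop: "weight (take k es) + weight (drop k es) = weight es"
  by (metis append_take_drop_id weight_append)

lemma length_le_weight: "length es \<le> weight es"
  by (induction es) (auto simp: weight_def)

lemma to_nat_on_less_weight: "e \<in> set es \<Longrightarrow> to_nat_on E e < weight es"
  by (induction es) (auto simp: weight_def)

definition low_paths :: "nat \<Rightarrow> ('v \<times> 'e list) set" where
  "low_paths n = {(v, es) \<in> paths. to_nat_on V v < n \<and> to_nat_on V (src v es) < n \<and> weight es < n}"

lemma low_paths_subset: "low_paths n \<subseteq> paths"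
  by (auto simp: low_paths_def)

lemma finite_low_paths: "finite (low_paths n)"
proof -
  let ?V = "{v \<in> V. to_nat_on V v < n}" and ?E = "{e \<in> E. to_nat_on E e < n}"
  have "low_paths n \<subseteq> ?V \<times> {es. set es \<subseteq> ?E \<and> length es \<le> n}"
  proof
    fix p
    assume "p \<in> low_paths n"
    then obtain v es where p: "p = (v, es)" and "v \<in> ?V" "set es \<subseteq> E" "weight es < n"
      by (auto simp: low_paths_def fsg_def)
    moreover have "set es \<subseteq> ?E"
      using to_nat_on_less_weight[of _ es] \<open>set es \<subseteq> E\<close> \<open>weight es < n\<close> by fastforce
    ultimately show "p \<in> ?V \<times> {es. set es \<subseteq> ?E \<and> length es \<le> n}"
      using length_le_weight[of es] by (simp add: p)
  qed
  moreover have "finite ?V" "finite ?E"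
    using graph by (auto simp: countable_graph_def intro: finite_to_nat_on_less)
  then have "finite (?V \<times> {es. set es \<subseteq> ?E \<and> length es \<le> n})"
    by (intro finite_cartesian_product finite_lists_length_le)
  ultimately show ?thesis
    by (rule finite_subset)
qed

definition fejer_weight :: "nat \<Rightarrow> 'v \<times> 'e list \<Rightarrow> complex" where
  "fejer_weight n p = (if p \<in> low_paths n then of_nat (n - weight (snd p)) / of_nat n else 0)"

definition fejer :: "('v, 'e) path_operator \<Rightarrow> nat \<Rightarrow>
    ('v \<times> 'e list \<Rightarrow> complex) \<Rightarrow> 'v \<times> 'e list \<Rightarrow> complex" where
  "fejer T n = (\<lambda>x q. \<Sum>p\<in>low_paths n. (fejer_weight n p * coef T p) * path_op p x q)"

lemma fejer_in_alg_gen: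
  assumes "V \<noteq> {}"
  shows "fejer T n \<in> alg_gen generators"
proof -
  obtain v where "v \<in> V"
    using assms by auto
  then show ?thesis
    unfolding fejer_def using low_paths_subset
    by (intro sum_in_alg_gen[of _ "P v"] finite_low_paths path_op_in_alg_gen)
      (auto intro: alg_gen.gen)
qed

lemma fejer_in_conv_ops: "V \<noteq> {} \<Longrightarrow> fejer T n \<in> conv_ops"
  by (rule alg_gen_in_conv_ops[OF fejer_in_alg_gen])

lemma coef_fejer:
  assumes "p \<in> paths"
  shows "coef (fejer T n) p = fejer_weight n p * coef T p"
proof -
  have "coef (fejer T n) p = (\<Sum>q\<in>low_paths n. (fejer_weight n q * coef T q) * coef (path_op q) p)"
    by (simp add: path_coef_def fejer_def case_prod_unfold)
  also have "\<dots> = (\<Sum>q\<in>low_paths n. (fejer_weight n q * coef T q) * xi q p)"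
    using assms by (intro sum.cong refl) (simp add: coef_path_op[OF subsetD[OF low_paths_subset]])
  also have "\<dots> = fejer_weight n p * coef T p"
    by (simp add: xi_apply fejer_weight_def of_bool_def if_distrib finite_low_paths cong: if_cong)
  finally show ?thesis .
qed

lemma fejer_apply:
  assumes "V \<noteq> {}" "x \<in> H" "p \<in> paths"
  shows "fejer T n x p = conv (\<lambda>q. fejer_weight n q * coef T q) x p"
  using assms conv_ops_apply[OF fejer_in_conv_ops] coef_fejer by (simp cong: conv_cong)

lemma fejer_weight_tendsto:
  assumes "p \<in> paths"
  shows "(\<lambda>n. fejer_weight n p) \<longlonglongrightarrow> 1"
proof -
  obtain v es where p: "p = (v, es)"
    by fastforce
  have "(\<lambda>n. 1 - complex_of_real (real (weight es) / real n)) \<longlonglongrightarrow> 1 - complex_of_real 0"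
    by (intro tendsto_diff tendsto_const tendsto_of_real lim_const_over_n)
  moreover have "\<forall>\<^sub>F n in sequentially.
      fejer_weight n p = 1 - complex_of_real (real (weight es) / real n)"
    unfolding eventually_sequentially
  proof (intro exI allI impI)
    fix n
    assume n: "Suc (weight es + to_nat_on V v + to_nat_on V (src v es)) \<le> n"
    then have "complex_of_nat (n - weight es) = of_nat n - of_nat (weight es)"
      by (simp add: of_nat_diff)
    then show "fejer_weight n p = 1 - complex_of_real (real (weight es) / real n)"
      using n assms by (simp add: p fejer_weight_def low_paths_def diff_divide_distrib)
  qed
  ultimately show ?thesis
    by (simp add: tendsto_cong)
qed

lemma fejer_tendsto_pointwise:
  assumes "V \<noteq> {}" "T \<in> conv_ops" "x \<in> H" "p \<in> paths"
  shows "(\<lambda>n. fejer T n x p) \<longlonglongrightarrow> T x p"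
proof -
  obtain v es where p: "p = (v, es)"
    by fastforce
  have "(\<lambda>n. conv (\<lambda>q. fejer_weight n q * coef T q) x p) \<longlonglongrightarrow> conv (\<lambda>q. 1 * coef T q) x p"
    using assms(4) unfolding p path_conv_def prod.case
    by (intro tendsto_sum tendsto_mult tendsto_const fejer_weight_tendsto path_take)
  then show ?thesis
    using assms by (simp add: fejer_apply conv_ops_apply)
qed

definition block :: "nat \<Rightarrow> nat \<Rightarrow> ('v \<times> 'e list) set" where
  "block n j = {(v, es). to_nat_on V v < n \<and> weight es \<le> j \<and> j < weight es + n}"

lemma card_blocks_containing_le: "card {j \<in> {..<N}. p \<in> block n j} \<le> n"
proof -
  have "{j \<in> {..<N}. p \<in> block n j} \<subseteq> {weight (snd p)..<weight (snd p) + n}"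
    by (auto simp: block_def)
  then have "card {j \<in> {..<N}. p \<in> block n j} \<le> card {weight (snd p)..<weight (snd p) + n}"
    by (intro card_mono) auto
  then show ?thesis
    by simp
qed

lemma card_blocks_containing_both:
  assumes "(v, es) \<in> paths" "0 < n" "weight es + n \<le> N"
  shows "of_nat (card {j \<in> {..<N}.
      (v, es) \<in> block n j \<and> (src v (take k es), drop k es) \<in> block n j}) =
    fejer_weight n (v, take k es) * of_nat n"
proof -
  note weight = weight_take_drop[of k es]
  let ?low = "to_nat_on V v < n \<and> to_nat_on V (src v (take k es)) < n"
  have "{j \<in> {..<N}. (v, es) \<in> block n j \<and> (src v (take k es), drop k es) \<in> block n j} =
      (if ?low then {weight es..<weight (drop k es) + n} else {})"
    using assms(3) weight by (auto simp: block_def)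
  moreover have "weight (drop k es) + n - weight es = n - weight (take k es)"
    using weight by simp
  ultimately show ?thesis
    using assms(1,2) by (auto simp: fejer_weight_def low_paths_def path_take)
qed

text \<open>Averaging the compressions of an operator to overlapping blocks of \<open>n\<close> consecutive weights
  multiplies its coefficient at \<open>es\<close> by \<open>1 - weight es / n\<close>; this bounds the norms of the Fejer
  means.\<close>

lemma fejer_eq_block_average:
  assumes "V \<noteq> {}" and T: "T \<in> conv_ops" and x: "x \<in> H" and p: "(v, es) \<in> paths"
    and n: "0 < n" and N: "weight es + n \<le> N"
  shows "fejer T n x (v, es) =
    (\<Sum>j<N. cutoff (block n j) (T (cutoff (block n j) x)) (v, es)) / of_nat n"
proof -
  let ?pre = "\<lambda>k. (v, take k es)" and ?suf = "\<lambda>k. (src v (take k es), drop k es)"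
  let ?both = "\<lambda>k j. (v, es) \<in> block n j \<and> ?suf k \<in> block n j"
  have compression: "cutoff (block n j) (T (cutoff (block n j) x)) (v, es) =
      (\<Sum>k\<le>length es. coef T (?pre k) * x (?suf k) * of_bool (?both k j))" for j
    using conv_ops_apply[OF T cutoff_in_ell2[OF x] p]
    by (simp add: pullback_def path_conv_def of_bool_def if_distrib cong: if_cong)
  have "(\<Sum>j<N. cutoff (block n j) (T (cutoff (block n j) x)) (v, es)) =
      (\<Sum>k\<le>length es. coef T (?pre k) * x (?suf k) * (\<Sum>j<N. of_bool (?both k j)))"
    unfolding compression by (subst sum.swap) (simp only: sum_distrib_left)
  also have "\<dots> = (\<Sum>k\<le>length es. coef T (?pre k) * x (?suf k) *
      of_nat (card {j \<in> {..<N}. ?both k j}))"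
    by (simp only: sum_of_bool_eq finite_lessThan Int_def mem_Collect_eq)
  also have "\<dots> = of_nat n * conv (\<lambda>q. fejer_weight n q * coef T q) x (v, es)"
    unfolding card_blocks_containing_both[OF p n N]
    by (simp add: path_conv_def sum_distrib_left mult_ac)
  finally show ?thesis
    using n by (simp add: fejer_apply[OF assms(1) x p])
qed

lemma hnorm_fejer_le:
  assumes V: "V \<noteq> {}" and T: "T \<in> conv_ops" and x: "x \<in> H"
    and C: "0 \<le> C" "\<And>x. x \<in> H \<Longrightarrow> hnorm (T x) \<le> C * hnorm x"
  shows "hnorm (fejer T n x) \<le> C * hnorm x"
proof (cases "n = 0")
  case True
  then show ?thesis
    using C by (simp add: fejer_def low_paths_def)
next
  case False
  show ?thesis
  proof (rule hnorm_le_if_L2_set_le)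
    fix W :: "('v \<times> 'e list) set"
    assume W: "finite W"
    define N where "N = (\<Sum>(v, es)\<in>W. weight es) + n"
    let ?A = "\<lambda>p. (\<Sum>j<N. cutoff (block n j) (T (cutoff (block n j) x)) p) / of_nat n"
    have "fejer T n x p = ?A p" if "p \<in> W" for p
    proof (cases "p \<in> paths")
      case True
      obtain v es where p: "p = (v, es)"
        by fastforce
      have "weight es \<le> (\<Sum>(v, es)\<in>W. weight es)"
        using member_le_sum[OF \<open>p \<in> W\<close>, of "\<lambda>(v, es). weight es"] W by (auto simp: p)
      then show ?thesis
        using True False unfolding p N_def by (intro fejer_eq_block_average V T x) auto
    next
      case False
      then show ?thesis
        using bop_eq_0_outside[OF conv_ops_in_bop[OF T]]
          bop_eq_0_outside[OF conv_ops_in_bop[OF fejer_in_conv_ops[OF V]]]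
        by (simp add: pullback_def cong: if_cong)
    qed
    then have "L2_set (\<lambda>p. cmod (fejer T n x p)) W = L2_set (\<lambda>p. cmod (?A p)) W"
      by (intro L2_set_cong) auto
    also have "\<dots> \<le> C * hnorm x"
      by (intro L2_set_block_average_le[of paths] bop_apply_in[OF conv_ops_in_bop[OF T]] C x
          card_blocks_containing_le) auto
    finally show "L2_set (\<lambda>p. cmod (fejer T n x p)) W \<le> C * hnorm x" .
  qed
qed

lemma
  assumes V: "V \<noteq> {}" and T: "T \<in> conv_ops"
  shows fejer_limitin_wot: "limitin (wot H) (fejer T) T sequentially"
    and fejer_limitin_weak_star: "limitin (weak_star_top H) (fejer T) T sequentially"
proof -
  obtain C where C: "0 \<le> C" "\<And>x. x \<in> H \<Longrightarrow> hnorm (T x) \<le> C * hnorm x"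
    using bop_bound[OF conv_ops_in_bop[OF T]] by blast
  show "limitin (wot H) (fejer T) T sequentially"
    by (rule limitin_wot_if_bounded_pointwise[OF conv_ops_in_bop[OF fejer_in_conv_ops[OF V]]
          conv_ops_in_bop[OF T] C(1) hnorm_fejer_le[OF V T _ C] fejer_tendsto_pointwise[OF V T]])
  show "limitin (weak_star_top H) (fejer T) T sequentially"
    by (rule limitin_weak_star_if_bounded_pointwise[OF conv_ops_in_bop[OF fejer_in_conv_ops[OF V]]
          conv_ops_in_bop[OF T] C(1) hnorm_fejer_le[OF V T _ C] fejer_tendsto_pointwise[OF V T]])
qed

text \<open>On the graph without vertices the generated algebra is empty and does not even contain the
  zero operator.\<close>

lemma fsga_eq: "fsga V E r s = (if V = {} then {} else conv_ops)"
proof (cases "V = {}")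
  case True
  then have "generators = {}"
    using range_in_V by blast
  then show ?thesis
    using True by (simp add: fsga_def tensor_alg_def alg_gen_empty)
next
  case False
  have "T \<in> fsga V E r s" if T: "T \<in> conv_ops" for T
  proof -
    have "limitin (subtopology (wot H) (bop H)) (fejer T) T sequentially"
      unfolding limitin_subtopology
      using fejer_limitin_wot[OF False T] T by (simp add: conv_ops_in_bop fejer_in_conv_ops False)
    then show ?thesis
      unfolding fsga_def HG_def
      by (rule limitin_subtopology_closure_of)
        (use fejer_in_alg_gen[OF False] alg_gen_subset_tensor_alg in blast)
  qed
  then show ?thesis
    using False fsga_subset_conv_ops by auto
qed

end

subsection \<open>Weak-* continuous characters and derivations\<close>

context graph
begin

abbreviation "\<LL> \<equiv> fsga V E r s"
abbreviation "fsga_top \<equiv> subtopology (weak_star_top H) \<LL>"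

lemma fsga_iff: "T \<in> \<LL> \<longleftrightarrow> V \<noteq> {} \<and> T \<in> conv_ops"
  by (simp add: fsga_eq)

lemma fsga_in_bop: "T \<in> \<LL> \<Longrightarrow> T \<in> bop H"
  by (simp add: fsga_iff conv_ops_in_bop)

lemma fsga_add: "S \<in> \<LL> \<Longrightarrow> T \<in> \<LL> \<Longrightarrow> op_add S T \<in> \<LL>"
  by (simp add: fsga_iff conv_ops_add)

lemma fsga_scale: "T \<in> \<LL> \<Longrightarrow> op_scale c T \<in> \<LL>"
  by (simp add: fsga_iff conv_ops_scale)

lemma fsga_comp: "S \<in> \<LL> \<Longrightarrow> T \<in> \<LL> \<Longrightarrow> S \<circ> T \<in> \<LL>"
  by (simp add: fsga_iff conv_ops_comp)

lemma path_op_in_fsga: "p \<in> paths \<Longrightarrow> path_op p \<in> \<LL>"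
  using path_start by (cases p) (auto simp: fsga_iff path_op_in_conv_ops)

lemma Pop_in_fsga: "v \<in> V \<Longrightarrow> P v \<in> \<LL>"
  using path_op_in_fsga[of "(v, [])"] by simp

lemma Lop_in_fsga: "e \<in> E \<Longrightarrow> L e \<in> \<LL>"
  by (metis empty_iff fsga_iff Lop_in_conv_ops source_in_V)

lemma zero_in_fsga: "V \<noteq> {} \<Longrightarrow> (\<lambda>x p. 0) \<in> \<LL>"
  using fsga_scale[OF Pop_in_fsga, of _ 0] by (auto simp: op_scale_def)

lemma sum_in_fsga:
  assumes "V \<noteq> {}" "finite I" "\<And>i. i \<in> I \<Longrightarrow> A i \<in> \<LL>"
  shows "(\<lambda>x p. \<Sum>i\<in>I. c i * A i x p) \<in> \<LL>"
  using assms(2,3)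
proof (induction I rule: finite_induct)
  case (insert i I)
  then have "op_add (op_scale (c i) (A i)) (\<lambda>x p. \<Sum>i\<in>I. c i * A i x p) \<in> \<LL>"
    by (intro fsga_add fsga_scale) auto
  then show ?case
    using insert by (simp add: op_add_def op_scale_def)
qed (simp add: zero_in_fsga[OF assms(1)])

definition weak_star_linear ::
  "(('v, 'e) path_operator \<Rightarrow> complex) \<Rightarrow> bool" where
  "weak_star_linear \<delta> \<longleftrightarrow>
    (\<forall>S\<in>\<LL>. \<forall>T\<in>\<LL>. \<delta> (op_add S T) = \<delta> S + \<delta> T) \<and>
    (\<forall>T\<in>\<LL>. \<forall>c. \<delta> (op_scale c T) = c * \<delta> T) \<and>
    continuous_map fsga_top euclidean \<delta>"

definition weak_star_char ::
  "(('v, 'e) path_operator \<Rightarrow> complex) \<Rightarrow> bool" where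
  "weak_star_char \<eta> \<longleftrightarrow>
    weak_star_linear \<eta> \<and> (\<forall>S\<in>\<LL>. \<forall>T\<in>\<LL>. \<eta> (S \<circ> T) = \<eta> S * \<eta> T) \<and> (\<exists>T\<in>\<LL>. \<eta> T \<noteq> 0)"

definition weak_star_deriv ::
  "(('v, 'e) path_operator \<Rightarrow> complex) \<Rightarrow> (('v, 'e) path_operator \<Rightarrow> complex) \<Rightarrow>
    (('v, 'e) path_operator \<Rightarrow> complex) \<Rightarrow> bool" where
  "weak_star_deriv \<eta>' \<eta> \<delta> \<longleftrightarrow>
    weak_star_linear \<delta> \<and> (\<forall>S\<in>\<LL>. \<forall>T\<in>\<LL>. \<delta> (S \<circ> T) = \<eta>' S * \<delta> T + \<delta> S * \<eta> T)"

definition char_at ::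
  "'v \<Rightarrow> (('v, 'e) path_operator \<Rightarrow> complex) \<Rightarrow> bool" where
  "char_at v \<eta> \<longleftrightarrow> weak_star_char \<eta> \<and> v \<in> V \<and> \<eta> (P v) = 1"

lemma weak_star_linear_zero:
  assumes "weak_star_linear \<delta>" "V \<noteq> {}"
  shows "\<delta> (\<lambda>x p. 0) = 0"
proof -
  have "\<delta> (op_scale 0 (\<lambda>x p. 0)) = 0"
    using assms zero_in_fsga by (simp add: weak_star_linear_def)
  then show ?thesis
    by (simp add: op_scale_def)
qed

lemma weak_star_linear_sum:
  assumes \<delta>: "weak_star_linear \<delta>" and "V \<noteq> {}" "finite I" "\<And>i. i \<in> I \<Longrightarrow> A i \<in> \<LL>"
  shows "\<delta> (\<lambda>x p. \<Sum>i\<in>I. c i * A i x p) = (\<Sum>i\<in>I. c i * \<delta> (A i))"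
  using assms(3,4)
proof (induction I rule: finite_induct)
  case (insert i I)
  let ?R = "\<lambda>x p. \<Sum>i\<in>I. c i * A i x p"
  have "?R \<in> \<LL>" "A i \<in> \<LL>"
    using insert assms(2) by (auto intro: sum_in_fsga)
  then have "\<delta> (op_add (op_scale (c i) (A i)) ?R) = c i * \<delta> (A i) + \<delta> ?R"
    using \<delta> fsga_scale by (simp add: weak_star_linear_def)
  then show ?case
    using insert by (simp add: op_add_def op_scale_def)
qed (simp add: weak_star_linear_zero[OF assms(1,2)])

lemma weak_star_linear_eq_0I:
  assumes \<delta>: "weak_star_linear \<delta>" and T: "T \<in> \<LL>"
    and zero: "\<And>p. p \<in> paths \<Longrightarrow> coef T p = 0 \<or> \<delta> (path_op p) = 0"
  shows "\<delta> T = 0"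
proof -
  have V: "V \<noteq> {}" and conv: "T \<in> conv_ops"
    using T by (simp_all add: fsga_iff)
  have "\<delta> (fejer T n) = 0" for n
  proof -
    have "\<delta> (fejer T n) = (\<Sum>p\<in>low_paths n. fejer_weight n p * coef T p * \<delta> (path_op p))"
      unfolding fejer_def
      using low_paths_subset
      by (intro weak_star_linear_sum \<delta> V finite_low_paths path_op_in_fsga) auto
    also have "\<dots> = 0"
      using zero low_paths_subset by (intro sum.neutral) fastforce
    finally show ?thesis .
  qed
  moreover have "limitin fsga_top (fejer T) T sequentially"
    using fejer_limitin_weak_star[OF V conv] T V
    by (simp add: limitin_subtopology fsga_iff fejer_in_conv_ops)
  then have "limitin euclidean (\<delta> \<circ> fejer T) (\<delta> T) sequentially"
    by (rule continuous_map_limit[rotated]) (use \<delta> in \<open>simp add: weak_star_linear_def\<close>)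
  ultimately have "(\<lambda>n. 0) \<longlonglongrightarrow> \<delta> T"
    by (simp add: o_def)
  then show ?thesis
    by (simp add: LIMSEQ_const_iff)
qed

lemma weak_star_linear_lincomb:
  assumes "weak_star_linear \<alpha>" "weak_star_linear \<beta>"
  shows "weak_star_linear (\<lambda>T. a * \<alpha> T + b * \<beta> T)"
proof -
  have "continuous_map fsga_top euclidean (\<lambda>T. a * \<alpha> T + b * \<beta> T)"
    using assms unfolding weak_star_linear_def continuous_map_atin limitin_canonical_iff
    by (auto intro!: tendsto_intros)
  then show ?thesis
    using assms by (simp add: weak_star_linear_def algebra_simps)
qed

lemma weak_star_deriv_zero: "weak_star_deriv \<eta>' \<eta> (\<lambda>T. 0)"
  by (simp add: weak_star_deriv_def weak_star_linear_def)

lemma weak_star_deriv_lincomb: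
  assumes "weak_star_deriv \<eta>' \<eta> \<alpha>" "weak_star_deriv \<eta>' \<eta> \<beta>"
  shows "weak_star_deriv \<eta>' \<eta> (\<lambda>T. a * \<alpha> T + b * \<beta> T)"
  using assms weak_star_linear_lincomb[of \<alpha> \<beta> a b]
  by (simp add: weak_star_deriv_def algebra_simps)

lemma weak_star_deriv_sum:
  assumes "finite I" "\<And>i. i \<in> I \<Longrightarrow> weak_star_deriv \<eta>' \<eta> (\<delta> i)"
  shows "weak_star_deriv \<eta>' \<eta> (\<lambda>T. \<Sum>i\<in>I. b i * \<delta> i T)"
  using assms
proof (induction I rule: finite_induct)
  case (insert i I)
  then have "weak_star_deriv \<eta>' \<eta> (\<lambda>T. b i * \<delta> i T + 1 * (\<Sum>i\<in>I. b i * \<delta> i T))"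
    by (intro weak_star_deriv_lincomb) auto
  then show ?case
    using insert by simp
qed (simp add: weak_star_deriv_zero)

lemma weak_star_deriv_inner:
  assumes "weak_star_char \<eta>'" "weak_star_char \<eta>"
  shows "weak_star_deriv \<eta>' \<eta> (\<lambda>T. \<eta>' T - \<eta> T)"
  using assms weak_star_linear_lincomb[of \<eta>' \<eta> 1 "-1"]
  by (simp add: weak_star_deriv_def weak_star_char_def algebra_simps)

lemma weak_star_linear_coef:
  assumes "p \<in> paths"
  shows "weak_star_linear (\<lambda>T. coef T p)"
proof -
  obtain v es where p: "p = (v, es)"
    by fastforce
  then have "xi (src v es, []) \<in> H"
    using assms by (simp add: path_source_in_V)
  then have "continuous_map fsga_top euclidean (\<lambda>T. coef T p)"
    using continuous_map_eval_weak_star[OF _ assms] by (simp add: path_coef_def p)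
  then show ?thesis
    by (simp add: weak_star_linear_def path_coef_op_add path_coef_op_scale)
qed

lemma char_at_coef_vertex:
  assumes "v \<in> V"
  shows "char_at v (\<lambda>T. coef T (v, []))"
proof -
  have "coef (S \<circ> T) (v, []) = coef S (v, []) * coef T (v, [])" if "S \<in> \<LL>" "T \<in> \<LL>" for S T
    using that assms by (simp add: fsga_iff coef_comp path_conv_def)
  moreover have "coef (P v) (v, []) = 1"
    using assms by (simp add: coef_Pop xi_apply)
  ultimately show ?thesis
    using assms Pop_in_fsga[OF assms] weak_star_linear_coef[of "(v, [])"]
    by (auto simp: char_at_def weak_star_char_def intro!: bexI[of _ "P v"])
qed

lemma weak_star_deriv_coef_edge:
  assumes "e \<in> E"
  shows "weak_star_deriv (\<lambda>T. coef T (r e, [])) (\<lambda>T. coef T (s e, [])) (\<lambda>T. coef T (r e, [e]))"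
  using assms weak_star_linear_coef[of "(r e, [e])"]
  by (simp add: weak_star_deriv_def fsga_iff coef_comp path_conv_def)

lemma Pop_comp_Lop: "e \<in> E \<Longrightarrow> P (r e) \<circ> L e = L e"
  by (rule bop_ext[of _ paths])
    (auto simp: comp_in_bop Pop_in_bop Lop_in_bop Pop_apply Lop_apply bop_apply_in[OF Lop_in_bop])

lemma Lop_comp_Pop: "e \<in> E \<Longrightarrow> L e \<circ> P (s e) = L e"
  by (rule bop_ext[of _ paths])
    (auto simp: comp_in_bop Pop_in_bop Lop_in_bop Pop_apply Lop_apply bop_apply_in[OF Pop_in_bop])

lemma Pop_comp_Pop: "P u \<circ> P v = (if u = v then P v else (\<lambda>x p. 0))"
proof -
  have "(\<lambda>x p. 0) \<in> bop H"
    using op_scale_in_bop[OF Pop_in_bop, of 0] by (simp add: op_scale_def)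
  then show ?thesis
    by (intro bop_ext[of _ paths])
      (auto simp: comp_in_bop Pop_in_bop Pop_apply bop_apply_in[OF Pop_in_bop])
qed

lemma weak_star_char_Pop_cases:
  assumes "weak_star_char \<eta>" "u \<in> V"
  shows "\<eta> (P u) = 0 \<or> \<eta> (P u) = 1"
proof -
  have "\<eta> (P u) = \<eta> (P u) * \<eta> (P u)"
    using assms Pop_in_fsga[of u] Pop_comp_Pop[of u u] by (metis weak_star_char_def)
  then show ?thesis
    by simp
qed

lemma char_at_Pop:
  assumes "char_at v \<eta>" "u \<in> V"
  shows "\<eta> (P u) = of_bool (u = v)"
proof (cases "u = v")
  case False
  have "\<eta> (P u \<circ> P v) = \<eta> (P u) * \<eta> (P v)"
    using assms Pop_in_fsga by (simp add: char_at_def weak_star_char_def)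
  moreover have "\<eta> (\<lambda>x p. 0) = 0"
    using assms by (intro weak_star_linear_zero) (auto simp: char_at_def weak_star_char_def)
  ultimately show ?thesis
    using assms(1) False by (simp add: Pop_comp_Pop char_at_def)
qed (use assms in \<open>simp add: char_at_def\<close>)

lemma weak_star_char_Lop:
  assumes "weak_star_char \<eta>" "e \<in> E"
  shows "\<eta> (L e) = \<eta> (P (r e)) * \<eta> (L e)" "\<eta> (L e) = \<eta> (L e) * \<eta> (P (s e))"
  using assms Pop_in_fsga Lop_in_fsga Pop_comp_Lop Lop_comp_Pop source_in_V range_in_V
  by (metis weak_star_char_def)+

lemma weak_star_char_path_op_Cons:
  assumes "weak_star_char \<eta>" "(v, e # es) \<in> paths"
  shows "\<eta> (path_op (v, e # es)) = \<eta> (L e) * \<eta> (path_op (s e, es))"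
  using assms Lop_in_fsga[of e] path_op_in_fsga[of "(s e, es)"] by (simp add: weak_star_char_def)

lemma weak_star_char_ex1_char_at:
  assumes "weak_star_char \<eta>"
  shows "\<exists>!v. char_at v \<eta>"
proof -
  have "\<exists>v\<in>V. \<eta> (P v) = 1"
  proof (rule ccontr)
    assume "\<not> ?thesis"
    then have P: "\<eta> (P v) = 0" if "v \<in> V" for v
      using weak_star_char_Pop_cases[OF assms that] that by blast
    then have "\<eta> (L e) = 0" if "e \<in> E" for e
      using weak_star_char_Lop(1)[OF assms that] that by simp
    then have "\<eta> (path_op p) = 0" if "p \<in> paths" for p
      using that P weak_star_char_path_op_Cons[OF assms]
      by (cases p rule: path_op.cases) auto
    then have "\<eta> T = 0" if "T \<in> \<LL>" for T
      using assms that by (intro weak_star_linear_eq_0I[of \<eta> T]) (auto simp: weak_star_char_def)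
    then show False
      using assms by (auto simp: weak_star_char_def)
  qed
  then obtain v where v: "char_at v \<eta>"
    using assms by (auto simp: char_at_def)
  moreover have "u = v" if "char_at u \<eta>" for u
    using char_at_Pop[OF v, of u] that by (simp add: char_at_def)
  ultimately show ?thesis
    by blast
qed

lemma char_at_Lop_nonzero:
  assumes "char_at v \<eta>" "e \<in> E" "\<eta> (L e) \<noteq> 0"
  shows "r e = v" "s e = v"
  using weak_star_char_Lop[of \<eta> e] char_at_Pop[OF assms(1)] assms by (auto simp: char_at_def)

lemma char_at_path_op_nonzero:
  assumes \<eta>: "char_at v \<eta>" and "(u, es) \<in> paths" "\<eta> (path_op (u, es)) \<noteq> 0"
  shows "u = v \<and> (\<forall>e\<in>set es. r e = v \<and> s e = v)"
  using assms(2,3)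
proof (induction es arbitrary: u)
  case Nil
  then show ?case
    using char_at_Pop[OF \<eta>] by simp
next
  case (Cons e es)
  have "\<eta> (path_op (u, e # es)) = \<eta> (L e) * \<eta> (path_op (s e, es))"
    using \<eta> by (intro weak_star_char_path_op_Cons Cons.prems) (simp add: char_at_def)
  then have nonzero: "\<eta> (L e) \<noteq> 0" "\<eta> (path_op (s e, es)) \<noteq> 0"
    using Cons.prems(2) by (auto simp del: path_op.simps)
  have e: "e \<in> E" "r e = u" "(s e, es) \<in> paths"
    using Cons.prems(1) by auto
  show ?case
    using Cons.IH[OF e(3) nonzero(2)] char_at_Lop_nonzero[OF \<eta> e(1) nonzero(1)] e(2) by simp
qed

text \<open>Restricting coefficients to words in the loops at \<open>v\<close> is multiplicative, so an idempotent
  yields an idempotent noncommutative power series, which has to be constant.\<close>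

lemma idempotent_coef_loops:
  assumes T: "T \<in> conv_ops" "T \<circ> T = T" and v: "v \<in> V"
    and "(v, es) \<in> paths" "\<forall>e\<in>set es. r e = v \<and> s e = v" "es \<noteq> []"
  shows "coef T (v, es) = 0"
  using assms(4-)
proof (induction "length es" arbitrary: es rule: less_induct)
  case less
  let ?c = "\<lambda>es. coef T (v, es)"
  have product: "?c fs = (\<Sum>k\<le>length fs. ?c (take k fs) * ?c (drop k fs))"
    if "(v, fs) \<in> paths" "\<forall>e\<in>set fs. r e = v \<and> s e = v" for fs
  proof -
    have "src v (take k fs) = v" for k
      using that(2) by (intro path_source_loops) (auto dest: in_set_takeD)
    then show ?thesis
      using coef_comp[OF T(1) T(1) that(1)] by (simp add: T(2) path_conv_def)
  qed
  have "?c (take k es) * ?c (drop k es) = 0" if "k \<le> length es" "k \<noteq> 0" "k \<noteq> length es" for k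
    using that less.prems less.hyps[of "take k es", OF _ path_take]
    by (auto dest: in_set_takeD)
  then have "(\<Sum>k\<le>length es. ?c (take k es) * ?c (drop k es)) =
      (\<Sum>k\<in>{0, length es}. ?c (take k es) * ?c (drop k es))"
    by (intro sum.mono_neutral_right) auto
  then have "?c es = 2 * ?c [] * ?c es"
    using product[OF less.prems(1,2)] less.prems(3) by simp
  moreover have "?c [] = ?c [] * ?c []"
    using product[of "[]"] v by simp
  then have "?c [] = 0 \<or> ?c [] = 1"
    by simp
  ultimately show ?case
    by auto
qed

lemma char_at_idempotent:
  assumes \<eta>: "char_at v \<eta>" and T: "T \<in> \<LL>" "T \<circ> T = T"
  shows "\<eta> T = coef T (v, [])"
proof -
  have v: "v \<in> V" and linear: "weak_star_linear \<eta>"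
    using \<eta> by (auto simp: char_at_def weak_star_char_def)
  let ?R = "op_add T (op_scale (- coef T (v, [])) (P v))"
  have "?R \<in> \<LL>"
    by (intro fsga_add fsga_scale T Pop_in_fsga v)
  then have "\<eta> ?R = 0"
  proof (rule weak_star_linear_eq_0I[OF linear])
    fix p
    assume p: "p \<in> paths"
    obtain u es where p_eq: "p = (u, es)"
      by fastforce
    have coef_R: "coef ?R p = coef T p - coef T (v, []) * xi (v, []) p"
      using coef_Pop[OF p] by (simp add: path_coef_op_add path_coef_op_scale)
    show "coef ?R p = 0 \<or> \<eta> (path_op p) = 0"
    proof (cases "\<eta> (path_op p) = 0")
      case False
      then have "u = v" "\<forall>e\<in>set es. r e = v \<and> s e = v"
        using char_at_path_op_nonzero[OF \<eta>] p p_eq by auto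
      then have "coef T p = coef T (v, []) * xi (v, []) p"
        using idempotent_coef_loops[of T v es] T v p by (auto simp: p_eq xi_apply fsga_iff)
      then show ?thesis
        by (simp add: coef_R)
    qed simp
  qed
  moreover have "\<eta> ?R = \<eta> T - coef T (v, []) * \<eta> (P v)"
    using linear T fsga_scale Pop_in_fsga[OF v] by (simp add: weak_star_linear_def)
  ultimately show ?thesis
    using \<eta> by (simp add: char_at_def)
qed

lemma weak_star_deriv_comp:
  "weak_star_deriv \<eta>' \<eta> \<delta> \<Longrightarrow> S \<in> \<LL> \<Longrightarrow> T \<in> \<LL> \<Longrightarrow> \<delta> (S \<circ> T) = \<eta>' S * \<delta> T + \<delta> S * \<eta> T"
  by (simp add: weak_star_deriv_def)

lemma weak_star_deriv_eq_0_if_zero_on_generators: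
  assumes \<delta>: "weak_star_deriv \<eta>' \<eta> \<delta>"
    and P: "\<And>v. v \<in> V \<Longrightarrow> \<delta> (P v) = 0" and L: "\<And>e. e \<in> E \<Longrightarrow> \<delta> (L e) = 0"
    and T: "T \<in> \<LL>"
  shows "\<delta> T = 0"
proof (rule weak_star_linear_eq_0I[OF _ T])
  show "weak_star_linear \<delta>"
    using \<delta> by (simp add: weak_star_deriv_def)
  have "\<delta> (path_op p) = 0" if "p \<in> paths" for p
    using that
  proof (induction p rule: path_op.induct)
    case (2 v e es)
    then show ?case
      using weak_star_deriv_comp[OF \<delta> Lop_in_fsga path_op_in_fsga, of e "(s e, es)"] L
      by (simp add: o_def)
  qed (simp add: P)
  then show "coef T p = 0 \<or> \<delta> (path_op p) = 0" if "p \<in> paths" for p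
    using that by blast
qed

lemma weak_star_deriv_Pop_eq_0:
  assumes \<eta>: "char_at v \<eta>" and \<eta>': "char_at w \<eta>'" and \<delta>: "weak_star_deriv \<eta>' \<eta> \<delta>"
    and "\<delta> (P v) = 0" and u: "u \<in> V"
  shows "\<delta> (P u) = 0"
proof -
  have v: "v \<in> V"
    using \<eta> by (simp add: char_at_def)
  then have "\<delta> (\<lambda>x p. 0) = 0"
    using \<delta> by (intro weak_star_linear_zero) (auto simp: weak_star_deriv_def)
  consider "u = v" | "u \<noteq> v" "u = w" | "u \<noteq> v" "u \<noteq> w"
    by blast
  then show ?thesis
  proof cases
    case 2
    then show ?thesis
      using weak_star_deriv_comp[OF \<delta> Pop_in_fsga[OF u] Pop_in_fsga[OF v]]
        \<open>\<delta> (P v) = 0\<close> \<open>\<delta> (\<lambda>x p. 0) = 0\<close> u v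
      by (simp add: Pop_comp_Pop char_at_Pop[OF \<eta>] char_at_Pop[OF \<eta>'])
  next
    case 3
    then show ?thesis
      using weak_star_deriv_comp[OF \<delta> Pop_in_fsga[OF u] Pop_in_fsga[OF u]] u
      by (simp add: Pop_comp_Pop char_at_Pop[OF \<eta>] char_at_Pop[OF \<eta>'])
  qed (use \<open>\<delta> (P v) = 0\<close> in simp)
qed

lemma weak_star_deriv_eq_0_if_zero_on_edges:
  assumes \<eta>: "char_at v \<eta>" and \<eta>': "char_at w \<eta>'" and \<delta>: "weak_star_deriv \<eta>' \<eta> \<delta>"
    and Pv: "\<delta> (P v) = 0" and Le: "\<And>e. e \<in> edges_between E r s v w \<Longrightarrow> \<delta> (L e) = 0"
    and T: "T \<in> \<LL>"
  shows "\<delta> T = 0"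
proof (rule weak_star_deriv_eq_0_if_zero_on_generators[OF \<delta> _ _ T])
  show P: "\<delta> (P u) = 0" if "u \<in> V" for u
    by (rule weak_star_deriv_Pop_eq_0[OF \<eta> \<eta>' \<delta> Pv that])
  show "\<delta> (L e) = 0" if e: "e \<in> E" for e
    using weak_star_deriv_comp[OF \<delta> Pop_in_fsga Lop_in_fsga[OF e], of "r e"]
      weak_star_deriv_comp[OF \<delta> Lop_in_fsga[OF e] Pop_in_fsga, of "s e"] Le[of e] e
    by (auto simp: Pop_comp_Lop Lop_comp_Pop P char_at_Pop[OF \<eta>] char_at_Pop[OF \<eta>']
        edges_between_def split: if_splits)
qed

lemma weak_star_deriv_inner_if_zero_on_edges:
  assumes \<eta>: "char_at v \<eta>" and \<eta>': "char_at w \<eta>'" and \<delta>: "weak_star_deriv \<eta>' \<eta> \<delta>"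
    and Le: "\<And>e. e \<in> edges_between E r s v w \<Longrightarrow> \<delta> (L e) = 0"
  shows "\<exists>k. \<forall>T\<in>\<LL>. \<delta> T = k * (\<eta>' T - \<eta> T)"
proof -
  have v: "v \<in> V"
    using \<eta> by (simp add: char_at_def)
  define k where "k = (if v = w then 0 else - \<delta> (P v))"
  let ?\<delta> = "\<lambda>T. 1 * \<delta> T + (- k) * (\<eta>' T - \<eta> T)"
  have deriv: "weak_star_deriv \<eta>' \<eta> ?\<delta>"
    using \<eta> \<eta>' by (intro weak_star_deriv_lincomb \<delta> weak_star_deriv_inner) (auto simp: char_at_def)
  have "?\<delta> (P v) = 0"
  proof (cases "v = w")
    case True
    then show ?thesis
      using weak_star_deriv_comp[OF \<delta> Pop_in_fsga[OF v] Pop_in_fsga[OF v]] v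
      by (simp add: k_def Pop_comp_Pop char_at_Pop[OF \<eta>] char_at_Pop[OF \<eta>'])
  next
    case False
    then show ?thesis
      using v by (simp add: k_def char_at_Pop[OF \<eta>] char_at_Pop[OF \<eta>'])
  qed
  moreover have "?\<delta> (L e) = 0" if e: "e \<in> edges_between E r s v w" for e
  proof (cases "v = w")
    case False
    then have "\<eta> (L e) = 0" "\<eta>' (L e) = 0"
      using e char_at_Lop_nonzero[OF \<eta>, of e] char_at_Lop_nonzero[OF \<eta>', of e]
      by (auto simp: edges_between_def)
    then show ?thesis
      using Le[OF e] by simp
  qed (simp add: k_def Le[OF e])
  ultimately have "?\<delta> T = 0" if "T \<in> \<LL>" for T
    using weak_star_deriv_eq_0_if_zero_on_edges[OF \<eta> \<eta>' deriv _ _ that] by blast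
  then show ?thesis
    by (intro exI[of _ k]) simp
qed

end

subsection \<open>Recovering the graph\<close>

lemma alg_iso_inverse:
  assumes iso: "alg_iso A B \<tau>"
    and inverse: "\<And>X. X \<in> A \<Longrightarrow> \<sigma> (\<tau> X) = X"
    and add: "\<And>X Y. X \<in> A \<Longrightarrow> Y \<in> A \<Longrightarrow> op_add X Y \<in> A"
    and comp: "\<And>X Y. X \<in> A \<Longrightarrow> Y \<in> A \<Longrightarrow> X \<circ> Y \<in> A"
    and scale: "\<And>X c. X \<in> A \<Longrightarrow> op_scale c X \<in> A"
  shows "alg_iso B A \<sigma>"
proof -
  have bij: "bij_betw \<tau> A B"
    using iso by (simp add: alg_iso_def)
  have B: "\<exists>X\<in>A. Y = \<tau> X" if "Y \<in> B" for Y
    using bij that by (auto simp: bij_betw_def)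
  have "bij_betw \<sigma> B A"
    by (rule bij_betw_byWitness[of _ \<tau>]) (use inverse bij in \<open>auto simp: bij_betw_def\<close>)
  moreover have "\<sigma> (op_add X Y) = op_add (\<sigma> X) (\<sigma> Y) \<and> \<sigma> (X \<circ> Y) = \<sigma> X \<circ> \<sigma> Y"
    if XY: "X \<in> B" "Y \<in> B" for X Y
  proof -
    obtain X' Y' where X'Y': "X' \<in> A" "Y' \<in> A" "X = \<tau> X'" "Y = \<tau> Y'"
      using B XY by metis
    then have "op_add X Y = \<tau> (op_add X' Y')" "X \<circ> Y = \<tau> (X' \<circ> Y')"
      using iso by (simp_all add: alg_iso_def)
    then show ?thesis
      using X'Y' by (simp add: inverse add comp)
  qed
  moreover have "\<sigma> (op_scale c X) = op_scale c (\<sigma> X)" if X: "X \<in> B" for X c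
  proof -
    obtain X' where X': "X' \<in> A" "X = \<tau> X'"
      using B X by blast
    then have "op_scale c X = \<tau> (op_scale c X')"
      using iso by (simp add: alg_iso_def)
    then show ?thesis
      using X' by (simp add: inverse scale)
  qed
  ultimately show ?thesis
    by (simp add: alg_iso_def)
qed

locale fsga_iso = G: graph V E r s + G': graph V' E' r' s'
  for V :: "'v set" and E :: "'e set" and r s :: "'e \<Rightarrow> 'v"
    and V' :: "'w set" and E' :: "'f set" and r' s' :: "'f \<Rightarrow> 'w" +
  fixes \<tau> \<sigma>
  assumes alg_iso: "alg_iso G.\<LL> G'.\<LL> \<tau>"
    and homeomorphic_maps: "homeomorphic_maps G.fsga_top G'.fsga_top \<tau> \<sigma>"
begin

lemma inverse: "X \<in> G.\<LL> \<Longrightarrow> \<sigma> (\<tau> X) = X"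
  using homeomorphic_maps by (auto simp: homeomorphic_maps_def)

lemma fsga_iso_inverse: "fsga_iso V' E' r' s' V E r s \<sigma> \<tau>"
proof
  show "alg_iso G'.\<LL> G.\<LL> \<sigma>"
    by (rule alg_iso_inverse[of "G.\<LL>" "G'.\<LL>" \<tau> \<sigma>, OF alg_iso inverse
          G.fsga_add G.fsga_comp G.fsga_scale])
  show "homeomorphic_maps G'.fsga_top G.fsga_top \<sigma> \<tau>"
    by (rule homeomorphic_maps_sym[THEN iffD1, OF homeomorphic_maps])
qed

lemma map_in_fsga: "X \<in> G.\<LL> \<Longrightarrow> \<tau> X \<in> G'.\<LL>"
  using alg_iso by (auto simp: alg_iso_def bij_betw_def)

lemma map_comp: "X \<in> G.\<LL> \<Longrightarrow> Y \<in> G.\<LL> \<Longrightarrow> \<tau> (X \<circ> Y) = \<tau> X \<circ> \<tau> Y"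
  using alg_iso by (simp add: alg_iso_def)

lemma weak_star_linear_pullback:
  assumes "G'.weak_star_linear \<delta>"
  shows "G.weak_star_linear (\<lambda>T. \<delta> (\<tau> T))"
proof -
  have "continuous_map G.fsga_top euclidean (\<delta> \<circ> \<tau>)"
    using homeomorphic_maps assms
    by (auto simp: homeomorphic_maps_def G'.weak_star_linear_def intro: continuous_map_compose)
  then show ?thesis
    using assms alg_iso map_in_fsga
    by (simp add: G.weak_star_linear_def G'.weak_star_linear_def alg_iso_def o_def)
qed

lemma weak_star_char_pullback:
  assumes "G'.weak_star_char \<eta>"
  shows "G.weak_star_char (\<lambda>T. \<eta> (\<tau> T))"
proof -
  have "\<tau> ` G.\<LL> = G'.\<LL>"
    using alg_iso by (simp add: alg_iso_def bij_betw_def)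
  then have "\<exists>T\<in>G.\<LL>. \<eta> (\<tau> T) \<noteq> 0"
    using assms unfolding G'.weak_star_char_def by (metis imageE)
  then show ?thesis
    using assms weak_star_linear_pullback[of \<eta>]
    by (auto simp: G.weak_star_char_def G'.weak_star_char_def map_comp map_in_fsga)
qed

lemma weak_star_deriv_pullback:
  "G'.weak_star_deriv \<eta>' \<eta> \<delta> \<Longrightarrow>
    G.weak_star_deriv (\<lambda>T. \<eta>' (\<tau> T)) (\<lambda>T. \<eta> (\<tau> T)) (\<lambda>T. \<delta> (\<tau> T))"
  using weak_star_linear_pullback[of \<delta>]
  by (simp add: G.weak_star_deriv_def G'.weak_star_deriv_def map_comp map_in_fsga)

definition vertex_map :: "'w \<Rightarrow> 'v" where
  "vertex_map w = (THE v. G.char_at v (\<lambda>T. G'.coef (\<tau> T) (w, [])))"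

lemma char_at_vertex_map:
  assumes "w \<in> V'"
  shows "G.char_at (vertex_map w) (\<lambda>T. G'.coef (\<tau> T) (w, []))"
  unfolding vertex_map_def
proof (rule theI'[OF G.weak_star_char_ex1_char_at])
  show "G.weak_star_char (\<lambda>T. G'.coef (\<tau> T) (w, []))"
    using G'.char_at_coef_vertex[OF assms]
    by (intro weak_star_char_pullback) (simp add: G'.char_at_def)
qed

lemma vertex_map_in: "w \<in> V' \<Longrightarrow> vertex_map w \<in> V"
  using char_at_vertex_map by (simp add: G.char_at_def)

end

sublocale fsga_iso \<subseteq> inv: fsga_iso V' E' r' s' V E r s \<sigma> \<tau>
  by (rule fsga_iso_inverse)

context fsga_iso
begin

text \<open>All characters at a vertex agree on the idempotent \<open>\<sigma> (P\<^sub>u)\<close>, in particular the coefficient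
  character and the one transported along \<open>\<tau>\<close>.\<close>

lemma vertex_map_inverse:
  assumes w: "w \<in> V'"
  shows "inv.vertex_map (vertex_map w) = w"
proof -
  let ?v = "vertex_map w" and ?u = "inv.vertex_map (vertex_map w)"
  have u: "?u \<in> V'" and "G.coef (\<sigma> (G'.P ?u)) (?v, []) = 1"
    using inv.char_at_vertex_map[OF vertex_map_in[OF w]] by (simp_all add: G'.char_at_def)
  moreover have "\<sigma> (G'.P ?u) \<circ> \<sigma> (G'.P ?u) = \<sigma> (G'.P ?u)"
    using inv.map_comp[of "G'.P ?u" "G'.P ?u"] G'.Pop_in_fsga[OF u] by (simp add: G'.Pop_comp_Pop)
  ultimately have "G'.coef (\<tau> (\<sigma> (G'.P ?u))) (w, []) = 1"
    using G.char_at_idempotent[OF char_at_vertex_map[OF w]] inv.map_in_fsga[OF G'.Pop_in_fsga[OF u]]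
    by simp
  then have "G'.coef (G'.P ?u) (w, []) = 1"
    using inv.inverse[OF G'.Pop_in_fsga[OF u]] by simp
  then show ?thesis
    using w by (simp add: G'.coef_Pop xi_apply split: if_splits)
qed

lemma card_edges_between_le:
  assumes vw: "v \<in> V'" "w \<in> V'"
    and F: "F \<subseteq> edges_between E' r' s' v w" "finite F"
    and finite: "finite (edges_between E r s (vertex_map v) (vertex_map w))"
  shows "card F \<le> card (edges_between E r s (vertex_map v) (vertex_map w))"
proof (rule card_unknowns_le_card_equations[OF finite F(2)])
  let ?d = "\<lambda>f T. G'.coef (\<tau> T) (w, [f])"
  let ?\<eta> = "\<lambda>T. G'.coef (\<tau> T) (v, [])" and ?\<eta>' = "\<lambda>T. G'.coef (\<tau> T) (w, [])"
  fix b f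
  assume zero: "\<And>e. e \<in> edges_between E r s (vertex_map v) (vertex_map w) \<Longrightarrow>
      (\<Sum>f\<in>F. b f * ?d f (G.L e)) = 0"
    and f: "f \<in> F"
  have "G.weak_star_deriv ?\<eta>' ?\<eta> (?d f)" if "f \<in> F" for f
    using weak_star_deriv_pullback[OF G'.weak_star_deriv_coef_edge[of f]] F(1) that
    by (auto simp: edges_between_def)
  then have deriv: "G.weak_star_deriv ?\<eta>' ?\<eta> (\<lambda>T. \<Sum>f\<in>F. b f * ?d f T)"
    by (rule G.weak_star_deriv_sum[OF F(2)])
  obtain k where inner: "(\<Sum>f\<in>F. b f * ?d f T) = k * (?\<eta>' T - ?\<eta> T)" if "T \<in> G.\<LL>" for T
    using G.weak_star_deriv_inner_if_zero_on_edges[OF char_at_vertex_map[OF vw(1)]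
        char_at_vertex_map[OF vw(2)] deriv zero] by blast
  have edge: "f \<in> E'" "r' f = w"
    using f F(1) by (auto simp: edges_between_def)
  have "(\<Sum>g\<in>F. b g * G'.coef (G'.L f) (w, [g])) =
      k * (G'.coef (G'.L f) (w, []) - G'.coef (G'.L f) (v, []))"
    using inner[OF inv.map_in_fsga[OF G'.Lop_in_fsga[OF edge(1)]]]
    by (simp add: inv.inverse G'.Lop_in_fsga[OF edge(1)])
  moreover have "G'.coef (G'.L f) (w, [g]) = of_bool (g = f)" if "g \<in> F" for g
    using that F(1) edge by (auto simp: edges_between_def G'.coef_Lop xi_apply)
  moreover have "G'.coef (G'.L f) (u, []) = 0" if "u \<in> V'" for u
    using that by (simp add: G'.coef_Lop xi_apply)
  ultimately show "b f = 0"
    using f F(2) vw by (simp add: of_bool_def if_distrib cong: if_cong)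
qed

lemma edges_between_lepoll:
  assumes "v \<in> V'" "w \<in> V'"
  shows "edges_between E' r' s' v w \<lesssim> edges_between E r s (vertex_map v) (vertex_map w)"
proof (rule lepoll_if_finite_subset_card_le)
  show "countable (edges_between E' r' s' v w)"
    using G'.graph by (auto simp: countable_graph_def edges_between_def)
qed (rule card_edges_between_le[OF assms])

end

context fsga_iso
begin

lemma bij_betw_vertex_map: "bij_betw vertex_map V' V"
  by (rule bij_betw_byWitness[of _ inv.vertex_map])
    (auto simp: vertex_map_inverse inv.vertex_map_inverse vertex_map_in inv.vertex_map_in)

lemma graph_iso: "graph_iso V' E' r' s' V E r s"
proof (rule graph_iso_if_edges_between_eqpoll[OF G'.graph G.graph bij_betw_vertex_map])
  fix v w
  assume vw: "v \<in> V'" "w \<in> V'"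
  have "edges_between E r s (vertex_map v) (vertex_map w) \<lesssim> edges_between E' r' s' v w"
    using inv.edges_between_lepoll[OF vertex_map_in vertex_map_in, OF vw]
    by (simp add: vertex_map_inverse vw)
  with edges_between_lepoll[OF vw]
  show "edges_between E' r' s' v w \<approx> edges_between E r s (vertex_map v) (vertex_map w)"
    by (rule lepoll_antisym)
qed

end

subsection \<open>Transport along a bijection of basis vectors\<close>

definition transport_op :: "'p set \<Rightarrow> 'q set \<Rightarrow> ('p \<Rightarrow> 'q) \<Rightarrow> ('q \<Rightarrow> 'p) \<Rightarrow>
    (('p \<Rightarrow> complex) \<Rightarrow> 'p \<Rightarrow> complex) \<Rightarrow> ('q \<Rightarrow> complex) \<Rightarrow> 'q \<Rightarrow> complex" where
  "transport_op A B h g X =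
    (\<lambda>y. if y \<in> ell2 B then pullback B g (X (pullback A h y)) else (\<lambda>p. 0))"

locale index_bij =
  fixes A :: "'p set" and B :: "'q set" and h :: "'p \<Rightarrow> 'q" and g :: "'q \<Rightarrow> 'p"
  assumes h_in: "p \<in> A \<Longrightarrow> h p \<in> B" and g_in: "q \<in> B \<Longrightarrow> g q \<in> A"
    and g_h: "p \<in> A \<Longrightarrow> g (h p) = p" and h_g: "q \<in> B \<Longrightarrow> h (g q) = q"
begin

lemma index_bij_inverse: "index_bij B A g h"
  by standard (simp_all add: h_in g_in g_h h_g)

lemma inj_on_h: "inj_on h A"
  by (rule inj_on_inverseI[of A g h]) (rule g_h)

lemma pullback_h_in: "y \<in> ell2 B \<Longrightarrow> pullback A h y \<in> ell2 A"
  by (rule pullback_in_ell2[OF _ inj_on_h])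

lemma pullback_h_g: "x \<in> ell2 A \<Longrightarrow> pullback A h (pullback B g x) = x"
  by (rule ext) (auto simp: pullback_def h_in g_h ell2_outside)

lemma pullback_h_xi: "p \<in> A \<Longrightarrow> pullback A h (xi (h p)) = xi p"
  by (rule ext) (auto simp: pullback_def xi_apply dest: inj_onD[OF inj_on_h])

lemma square_summable_seq_pullback:
  assumes "square_summable_seq (ell2 B) ys"
  shows "square_summable_seq (ell2 A) (\<lambda>n. pullback A h (ys n))"
proof -
  have ys: "ys n \<in> ell2 B" for n
    using assms by (simp add: square_summable_seq_def)
  have "(\<lambda>n. (hnorm (pullback A h (ys n)))\<^sup>2) summable_on UNIV"
    by (rule summable_on_comparison_test[of "\<lambda>n. (hnorm (ys n))\<^sup>2"])
      (use assms in \<open>auto simp: square_summable_seq_def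
        intro!: power_mono hnorm_pullback_le[OF ys inj_on_h]\<close>)
  then show ?thesis
    by (simp add: square_summable_seq_def pullback_h_in ys)
qed

abbreviation "transport \<equiv> transport_op A B h g"

lemma transport_apply: "y \<in> ell2 B \<Longrightarrow> q \<in> B \<Longrightarrow> transport X y q = X (pullback A h y) (g q)"
  by (simp add: transport_op_def pullback_def)

lemma transport_add: "transport (op_add X Y) = op_add (transport X) (transport Y)"
  by (intro ext) (simp add: transport_op_def op_add_def pullback_def)

lemma transport_scale: "transport (op_scale c X) = op_scale c (transport X)"
  by (intro ext) (simp add: transport_op_def op_scale_def pullback_def)

interpretation inv: index_bij B A g h
  by (rule index_bij_inverse)

lemma iprod_pullback_g: "iprod (pullback B g x) y = iprod x (pullback A h y)"
proof -
  have "iprod (pullback B g x) y = (\<Sum>\<^sub>\<infinity>q\<in>B. x (g q) * cnj (y q))"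
    unfolding iprod_def by (rule infsum_cong_neutral) (auto simp: pullback_def)
  also have "\<dots> = (\<Sum>\<^sub>\<infinity>p\<in>A. x (g (h p)) * cnj (y (h p)))"
    by (rule infsum_reindex_bij_betw[symmetric], rule bij_betw_byWitness[where f' = g])
      (auto simp: h_in g_in g_h h_g)
  also have "\<dots> = iprod x (pullback A h y)"
    unfolding iprod_def by (rule infsum_cong_neutral) (auto simp: pullback_def g_h)
  finally show ?thesis .
qed

lemma transport_in_bop:
  assumes X: "X \<in> bop (ell2 A)"
  shows "transport X \<in> bop (ell2 B)"
proof -
  obtain C where C: "0 \<le> C" "\<And>x. x \<in> ell2 A \<Longrightarrow> hnorm (X x) \<le> C * hnorm x"
    using bop_bound[OF X] by blast
  show ?thesis
  proof (rule bopI[where C = C])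
    fix y
    assume y: "y \<in> ell2 B"
    note X_in = bop_apply_in[OF X pullback_h_in[OF y]]
    show "transport X y \<in> ell2 B"
      using inv.pullback_h_in[OF X_in] y by (simp add: transport_op_def)
    have "hnorm (transport X y) \<le> hnorm (X (pullback A h y))"
      using hnorm_pullback_le[OF X_in inv.inj_on_h] y by (simp add: transport_op_def)
    also have "\<dots> \<le> C * hnorm (pullback A h y)"
      by (rule C(2)[OF pullback_h_in[OF y]])
    also have "\<dots> \<le> C * hnorm y"
      by (intro mult_left_mono hnorm_pullback_le[OF y inj_on_h] C)
    finally show "hnorm (transport X y) \<le> C * hnorm y" .
  next
    fix y z a b
    assume "y \<in> ell2 B" "z \<in> ell2 B"
    then show "transport X (\<lambda>p. a * y p + b * z p) =
        (\<lambda>p. a * transport X y p + b * transport X z p)"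
      using bop_lincomb[OF X pullback_h_in pullback_h_in]
      by (simp add: transport_op_def ell2_lincomb pullback_lincomb)
  qed (simp add: transport_op_def)
qed

lemma transport_comp:
  assumes "X \<in> bop (ell2 A)" "Y \<in> bop (ell2 A)"
  shows "transport (X \<circ> Y) = transport X \<circ> transport Y"
proof
  fix y
  show "transport (X \<circ> Y) y = (transport X \<circ> transport Y) y"
  proof (cases "y \<in> ell2 B")
    case True
    then show ?thesis
      using bop_apply_in[OF assms(2) pullback_h_in[OF True]]
      by (simp add: transport_op_def inv.pullback_h_in pullback_h_g)
  next
    case False
    then have "transport Y y = (\<lambda>p. 0)" "transport (X \<circ> Y) y = (\<lambda>p. 0)"
      by (simp_all add: transport_op_def)
    then show ?thesis
      using bop_zero[OF transport_in_bop[OF assms(1)]] by simp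
  qed
qed

lemma transport_inverse:
  assumes "X \<in> bop (ell2 A)"
  shows "inv.transport (transport X) = X"
proof
  fix x
  show "inv.transport (transport X) x = X x"
  proof (cases "x \<in> ell2 A")
    case True
    then show ?thesis
      using bop_apply_in[OF assms True]
      by (simp add: transport_op_def inv.pullback_h_in pullback_h_g)
  next
    case False
    then show ?thesis
      using bop_outside[OF assms] by (simp add: transport_op_def)
  qed
qed

lemma sigma_weak_fun_transport:
  assumes "\<And>n. xs n \<in> ell2 B"
  shows "sigma_weak_fun xs ys (transport X) =
    sigma_weak_fun (\<lambda>n. pullback A h (xs n)) (\<lambda>n. pullback A h (ys n)) X"
  using assms by (simp add: sigma_weak_fun_def transport_op_def iprod_pullback_g)

lemma continuous_map_transport:
  assumes "transport ` \<A> \<subseteq> \<B>"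
  shows "continuous_map (subtopology (weak_star_top (ell2 A)) \<A>)
    (subtopology (weak_star_top (ell2 B)) \<B>) transport"
proof -
  have "continuous_map (weak_star_top (ell2 A)) (weak_star_top (ell2 B)) transport"
    unfolding weak_star_top_eq_initial_topology[of "ell2 B"]
  proof (rule continuous_map_into_initial_topology[OF weak_star_functionals_nonempty])
    fix f
    assume "f \<in> weak_star_functionals (ell2 B)"
    then obtain xs ys where f: "f = sigma_weak_fun xs ys"
      and xs: "square_summable_seq (ell2 B) xs" and ys: "square_summable_seq (ell2 B) ys"
      unfolding weak_star_functionals_def by blast
    have "f \<circ> transport = sigma_weak_fun (\<lambda>n. pullback A h (xs n)) (\<lambda>n. pullback A h (ys n))"
      using xs by (auto simp: f square_summable_seq_def sigma_weak_fun_transport)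
    then show "continuous_map (weak_star_top (ell2 A)) euclidean (f \<circ> transport)"
      unfolding weak_star_top_eq_initial_topology
      using square_summable_seq_pullback[OF xs] square_summable_seq_pullback[OF ys]
      by (intro continuous_map_from_initial_topology) (auto simp: weak_star_functionals_def)
  qed
  then show ?thesis
    using assms
    by (auto simp: continuous_map_in_subtopology intro: continuous_map_from_subtopology)
qed

end

locale graph_bij = G: graph V E r s + G': graph V' E' r' s'
    + vertices: index_bij V V' \<phi> \<phi>i + edges: index_bij E E' \<psi> \<psi>i
  for V :: "'v set" and E :: "'e set" and r s :: "'e \<Rightarrow> 'v"
    and V' :: "'w set" and E' :: "'f set" and r' s' :: "'f \<Rightarrow> 'w" and \<phi> \<phi>i \<psi> \<psi>i +
  assumes range_map: "e \<in> E \<Longrightarrow> r' (\<psi> e) = \<phi> (r e)"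
    and source_map: "e \<in> E \<Longrightarrow> s' (\<psi> e) = \<phi> (s e)"
begin

lemma graph_bij_inverse: "graph_bij V' E' r' s' V E r s \<phi>i \<phi> \<psi>i \<psi>"
proof
  show "r (\<psi>i f) = \<phi>i (r' f)" "s (\<psi>i f) = \<phi>i (s' f)" if "f \<in> E'" for f
    using range_map[OF edges.g_in[OF that]] source_map[OF edges.g_in[OF that]] that
    by (simp_all add: edges.h_g edges.g_in vertices.g_h)
qed (simp_all add: vertices.h_in vertices.g_in vertices.g_h vertices.h_g
    edges.h_in edges.g_in edges.g_h edges.h_g)

abbreviation "path_map \<equiv> map_prod \<phi> (map \<psi>)"
abbreviation "path_map_inv \<equiv> map_prod \<phi>i (map \<psi>i)"

lemma path_map_in: "(v, es) \<in> G.paths \<Longrightarrow> (\<phi> v, map \<psi> es) \<in> G'.paths"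
  by (induction es arbitrary: v)
    (auto simp: vertices.h_in edges.h_in range_map source_map)

lemma path_map_inverse: "p \<in> G.paths \<Longrightarrow> path_map_inv (path_map p) = p"
  by (cases p) (auto simp: fsg_def vertices.g_h edges.g_h intro!: map_idI)

lemma path_source_map: "(v, es) \<in> G.paths \<Longrightarrow> G'.src (\<phi> v) (map \<psi> es) = \<phi> (G.src v es)"
  by (induction es arbitrary: v) (auto simp: source_map)

end

sublocale graph_bij \<subseteq> inv: graph_bij V' E' r' s' V E r s \<phi>i \<phi> \<psi>i \<psi>
  by (rule graph_bij_inverse)

context graph_bij
begin

lemma index_bij_paths: "index_bij G.paths G'.paths path_map path_map_inv"
  by standard (auto simp: path_map_in inv.path_map_in
      path_map_inverse[simplified] inv.path_map_inverse[simplified])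

sublocale index_bij G.paths G'.paths path_map path_map_inv
  by (rule index_bij_paths)

lemma coef_transport:
  assumes "p \<in> G.paths"
  shows "G'.coef (transport X) (path_map p) = G.coef X p"
proof -
  obtain v es where p: "p = (v, es)"
    by fastforce
  have source: "G.src v es \<in> V"
    using assms by (simp add: p G.path_source_in_V)
  then have "xi (\<phi> (G.src v es), []) \<in> G'.H"
    by (simp add: vertices.h_in)
  then show ?thesis
    using assms path_map_inverse[OF assms] pullback_h_xi[of "(G.src v es, [])"] source
    by (simp add: p path_coef_def path_source_map path_map_in transport_apply)
qed

lemma conv_path_map:
  assumes "p \<in> G.paths"
  shows "G'.conv a b (path_map p) = G.conv (\<lambda>q. a (path_map q)) (\<lambda>q. b (path_map q)) p"
proof -
  obtain v es where p: "p = (v, es)"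
    by fastforce
  show ?thesis
    using assms G.path_take[of v es]
    by (simp add: p path_conv_def take_map drop_map path_source_map)
qed

lemma transport_in_conv_ops:
  assumes X: "X \<in> G.conv_ops"
  shows "transport X \<in> G'.conv_ops"
proof (rule G'.conv_opsI)
  show "transport X \<in> bop G'.H"
    by (rule transport_in_bop[OF G.conv_ops_in_bop[OF X]])
  fix y q
  assume y: "y \<in> G'.H" and q: "q \<in> G'.paths"
  let ?p = "path_map_inv q"
  have p: "?p \<in> G.paths"
    by (rule g_in[OF q])
  have "transport X y q = G.conv (G.coef X) (pullback G.paths path_map y) ?p"
    using y q p by (simp add: transport_apply G.conv_ops_apply[OF X] pullback_h_in)
  also have "\<dots> = G.conv (\<lambda>p. G'.coef (transport X) (path_map p)) (\<lambda>p. y (path_map p)) ?p"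
    using p by (intro G.conv_cong) (simp_all add: coef_transport pullback_def)
  also have "\<dots> = G'.conv (G'.coef (transport X)) y q"
    using conv_path_map[OF p, of "G'.coef (transport X)" y] h_g[OF q] by simp
  finally show "transport X y q = G'.conv (G'.coef (transport X)) y q" .
qed

lemma transport_in_fsga: "X \<in> G.\<LL> \<Longrightarrow> transport X \<in> G'.\<LL>"
  using vertices.h_in by (auto simp: G.fsga_iff G'.fsga_iff transport_in_conv_ops)

end

context graph_bij
begin

lemma fsga_iso_transport: "fsga_iso V E r s V' E' r' s' transport inv.transport"
proof
  have inverse: "inv.transport (transport X) = X" if "X \<in> G.\<LL>" for X
    by (rule transport_inverse[OF G.fsga_in_bop[OF that]])
  have inv_inverse: "transport (inv.transport Y) = Y" if "Y \<in> G'.\<LL>" for Y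
    by (rule inv.transport_inverse[OF G'.fsga_in_bop[OF that]])
  have "bij_betw transport G.\<LL> G'.\<LL>"
    by (rule bij_betw_byWitness[where f' = inv.transport])
      (auto simp: inverse inv_inverse transport_in_fsga inv.transport_in_fsga)
  then show "alg_iso G.\<LL> G'.\<LL> transport"
    by (simp add: alg_iso_def transport_add transport_scale transport_comp G.fsga_in_bop)
  show "homeomorphic_maps G.fsga_top G'.fsga_top transport inv.transport"
    unfolding homeomorphic_maps_def
    by (auto simp: transport_in_fsga inv.transport_in_fsga inverse inv_inverse
        intro!: continuous_map_transport inv.continuous_map_transport)
qed

end

lemma index_bij_inv_into: "bij_betw h A B \<Longrightarrow> index_bij A B h (inv_into A h)"
  by standard
    (auto simp: bij_betw_apply bij_betw_inv_into_left bij_betw_inv_into_right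
      bij_betw_apply[OF bij_betw_inv_into])

lemma fsga_iso_if_graph_iso:
  assumes "countable_graph V E r s" "countable_graph V' E' r' s'" "graph_iso V E r s V' E' r' s'"
  shows "\<exists>\<tau> \<sigma>. fsga_iso V E r s V' E' r' s' \<tau> \<sigma>"
proof -
  obtain \<phi> \<psi> where \<phi>: "bij_betw \<phi> V V'" and \<psi>: "bij_betw \<psi> E E'"
    and "\<forall>e\<in>E. r' (\<psi> e) = \<phi> (r e) \<and> s' (\<psi> e) = \<phi> (s e)"
    using assms(3) by (auto simp: graph_iso_def)
  with assms(1,2)
  interpret graph_bij V E r s V' E' r' s' \<phi> "inv_into V \<phi>" \<psi> "inv_into E \<psi>"
    by (intro graph_bij.intro graph_bij_axioms.intro graph.intro index_bij_inv_into) auto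
  show ?thesis
    using fsga_iso_transport by blast
qed

theorem theorem3p8:
  fixes V :: "'v set" and E :: "'e set" and r s :: "'e \<Rightarrow> 'v"
    and V' :: "'w set" and E' :: "'f set" and r' s' :: "'f \<Rightarrow> 'w"
  assumes "countable_graph V E r s" and "countable_graph V' E' r' s'"
  shows "(\<exists>\<tau>. alg_iso (fsga V E r s) (fsga V' E' r' s') \<tau> \<and>
            homeomorphic_map (subtopology (weak_star_top (HG V E r s)) (fsga V E r s))
                             (subtopology (weak_star_top (HG V' E' r' s')) (fsga V' E' r' s')) \<tau>)
         \<longleftrightarrow> graph_iso V E r s V' E' r' s'"
proof -
  interpret G: graph V E r s
    by unfold_locales (rule assms(1))
  interpret G': graph V' E' r' s'
    by unfold_locales (rule assms(2))
  show ?thesis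
    unfolding HG_def
  proof
    assume "\<exists>\<tau>. alg_iso G.\<LL> G'.\<LL> \<tau> \<and> homeomorphic_map G.fsga_top G'.fsga_top \<tau>"
    then obtain \<tau> \<sigma> where "alg_iso G.\<LL> G'.\<LL> \<tau>" "homeomorphic_maps G.fsga_top G'.fsga_top \<tau> \<sigma>"
      by (auto simp: homeomorphic_map_maps)
    then interpret fsga_iso V E r s V' E' r' s' \<tau> \<sigma>
      by unfold_locales
    show "graph_iso V E r s V' E' r' s'"
      by (rule inv.graph_iso)
  next
    assume "graph_iso V E r s V' E' r' s'"
    then obtain \<tau> \<sigma> where "fsga_iso V E r s V' E' r' s' \<tau> \<sigma>"
      using fsga_iso_if_graph_iso assms by blast
    then interpret fsga_iso V E r s V' E' r' s' \<tau> \<sigma> .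
    show "\<exists>\<tau>. alg_iso G.\<LL> G'.\<LL> \<tau> \<and> homeomorphic_map G.fsga_top G'.fsga_top \<tau>"
      using alg_iso homeomorphic_maps by (auto simp: homeomorphic_map_maps)
  qed
qed

end
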